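(* For every $k\in\mathbb{N}$, none of the following functionals is computable (in Kleene's S1–S9 sense) in $\mathsf{S}_k^{2}$, and each of them, together with $\exists^{2}$, computes a Cantor realiser: (a) any functional $\Phi:(\mathbb{R}\to\mathbb{R})\to\mathbb{R}$ such that for all usco $f:[0,1]\to[0,1]$ we have $\Phi(f)\in C_f$; (b) any functional $\Psi:(\mathbb{R}\to\mathbb{R})\to(\mathbb{R}^2\to\mathbb{R})$ such that for all usco $f:[0,1]\to[0,1]$ we have $\Psi(f,p,q)=\sup_{x\in[p,q]}f(x)$ for $p,q\in[0,1]$; (c) any functional $\zeta:(\mathbb{R}\to\mathbb{R})\to((\mathbb{N}\times\mathbb{N})\to\mathbb{Q}^2)$ such that for all usco $f:[0,1]\to[0,1]$ and all $n,m$, $\zeta(f,m,n)$ is an open interval with rational endpoints and $C_f=\bigcap_{n\in\mathbb{N}}\bigcup_{m\in\mathbb{N}}\zeta(f,m,n)$. The same holds for the variants of (a)–(c) in which the usco function $f$ is additionally provided together with its oscillation function $\mathsf{osc}_f$ as input.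
   Context: Computability is Kleene's higher-order computability given by S1–S9. $\exists^{2}$ is the functional $\varphi:\mathbb{N}^{\mathbb{N}}\to\{0,1\}$ with $\varphi(f)=0\leftrightarrow(\exists n)(f(n)=0)$. $\mathsf{S}_k^{2}$ is the type-2 functional deciding the truth of $\Sigma^1_k$-formulas (parameters over $\mathbb{N}$ and $\mathbb{N}^{\mathbb{N}}$ only). A function $f:[0,1]\to\mathbb{R}$ is upper semi-continuous (usco) at $x_0$ if for any $y>f(x_0)$ there is $N$ with $f(z)<y$ for all $z\in B(x_0,2^{-N})$; usco means usco everywhere. $C_f$ is the set of points where $f$ is continuous. The oscillation function is $\mathsf{osc}_f([a,b]):=\sup_{[a,b]}f-\inf_{[a,b]}f$ and $\mathsf{osc}_f(x):=\lim_{k\to\infty}\mathsf{osc}_f(B(x,2^{-k}))$. Subsets of $\mathbb{R}$ are given by characteristic functions. A Cantor realiser is any $\Phi:((\mathbb{R}\to\{0,1\})\times(\mathbb{R}\to\mathbb{N}))\to\mathbb{R}$ such that $\Phi(A,Y)\notin A$ whenever $A\subset[0,1]$ is non-empty and $Y:[0,1]\to\mathbb{N}$ is injective on $A$. *)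

theory Defs
  imports "HOL-Analysis.Analysis" "HOL-Library.Nat_Bijection"
begin

section \<open>Kleene computability S1--S9\<close>

type_synonym tp1 = "nat \<Rightarrow> nat"
type_synonym tp2 = "tp1 \<Rightarrow> nat"
type_synonym tp3 = "tp2 \<Rightarrow> nat"

text \<open>Schemes S1--S9 applied to arguments of pure type at most 3 only generate
  subcomputations whose arguments are again of pure type at most 3.\<close>

datatype obj = O0 nat | O1 tp1 | O2 tp2 | O3 tp3

text \<open>\<open>kleene e as y\<close> means that \<open>{e}(as)\<close> is defined with value \<open>y\<close>. The argument list mixes
  types, so the signature of the arguments is read off from the list and is not part of the index.
  The functions \<open>h\<close> in S8 are total: \<open>{e}(as)\<close> is undefined if some \<open>{d}(x,as)\<close> is.\<close>

inductive kleene :: "nat \<Rightarrow> obj list \<Rightarrow> nat \<Rightarrow> bool" where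
  S1: "kleene (list_encode [1]) (O0 x # as) (Suc x)"
| S2: "kleene (list_encode [2, q]) as q"
| S3: "kleene (list_encode [3]) (O0 x # as) x"
| S4: "kleene b as x \<Longrightarrow> kleene d (O0 x # as) y \<Longrightarrow> kleene (list_encode [4, d, b]) as y"
| S5_0: "kleene b as y \<Longrightarrow> kleene (list_encode [5, b, d]) (O0 0 # as) y"
| S5_Suc: "kleene (list_encode [5, b, d]) (O0 x # as) z \<Longrightarrow> kleene d (O0 x # O0 z # as) y \<Longrightarrow>
    kleene (list_encode [5, b, d]) (O0 (Suc x) # as) y"
| S6: "i < length as \<Longrightarrow> kleene d (as ! i # take i as @ drop (Suc i) as) y \<Longrightarrow>
    kleene (list_encode [6, d, i]) as y"
| S7: "kleene (list_encode [7]) (O1 f # O0 x # as) (f x)"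
| S8_2: "(\<And>x. kleene d (O0 x # O2 F # as) (h x)) \<Longrightarrow> kleene (list_encode [8, d]) (O2 F # as) (F h)"
| S8_3: "(\<And>g. kleene d (O1 g # O3 G # as) (h g)) \<Longrightarrow> kleene (list_encode [8, d]) (O3 G # as) (G h)"
| S9: "m \<le> length as \<Longrightarrow> kleene x (take m as) y \<Longrightarrow> kleene (list_encode [9, m]) (O0 x # as) y"

section \<open>The functionals \<open>\<exists>\<^sup>2\<close> and \<open>S\<^sub>k\<^sup>2\<close>\<close>

definition E2 :: tp2 where
  "E2 f = (if \<exists>n. f n = 0 then 0 else 1)"

text \<open>Second-order arithmetic with function variables; number variables and function variables
  are de Bruijn indices of two separate sorts. \<open>FApp i t\<close> is the \<open>i\<close>-th function variable
  applied to \<open>t\<close>.\<close>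

datatype tm = NVar nat | Zero | Succ tm | Plus tm tm | Times tm tm | FApp nat tm

datatype fm = Eq tm tm | Neg fm | Conj fm fm | ExN fm | AllN fm | ExF fm | AllF fm

primrec tm_val :: "(nat \<Rightarrow> nat) \<Rightarrow> (nat \<Rightarrow> tp1) \<Rightarrow> tm \<Rightarrow> nat" where
  "tm_val \<nu> \<rho> (NVar i) = \<nu> i"
| "tm_val \<nu> \<rho> Zero = 0"
| "tm_val \<nu> \<rho> (Succ t) = Suc (tm_val \<nu> \<rho> t)"
| "tm_val \<nu> \<rho> (Plus s t) = tm_val \<nu> \<rho> s + tm_val \<nu> \<rho> t"
| "tm_val \<nu> \<rho> (Times s t) = tm_val \<nu> \<rho> s * tm_val \<nu> \<rho> t"
| "tm_val \<nu> \<rho> (FApp i t) = \<rho> i (tm_val \<nu> \<rho> t)"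

primrec fm_true :: "(nat \<Rightarrow> nat) \<Rightarrow> (nat \<Rightarrow> tp1) \<Rightarrow> fm \<Rightarrow> bool" where
  "fm_true \<nu> \<rho> (Eq s t) \<longleftrightarrow> tm_val \<nu> \<rho> s = tm_val \<nu> \<rho> t"
| "fm_true \<nu> \<rho> (Neg \<phi>) \<longleftrightarrow> \<not> fm_true \<nu> \<rho> \<phi>"
| "fm_true \<nu> \<rho> (Conj \<phi> \<psi>) \<longleftrightarrow> fm_true \<nu> \<rho> \<phi> \<and> fm_true \<nu> \<rho> \<psi>"
| "fm_true \<nu> \<rho> (ExN \<phi>) \<longleftrightarrow> (\<exists>n. fm_true (case_nat n \<nu>) \<rho> \<phi>)"
| "fm_true \<nu> \<rho> (AllN \<phi>) \<longleftrightarrow> (\<forall>n. fm_true (case_nat n \<nu>) \<rho> \<phi>)"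
| "fm_true \<nu> \<rho> (ExF \<phi>) \<longleftrightarrow> (\<exists>g. fm_true \<nu> (case_nat g \<rho>) \<phi>)"
| "fm_true \<nu> \<rho> (AllF \<phi>) \<longleftrightarrow> (\<forall>g. fm_true \<nu> (case_nat g \<rho>) \<phi>)"

primrec arithmetical :: "fm \<Rightarrow> bool" where
  "arithmetical (Eq s t) \<longleftrightarrow> True"
| "arithmetical (Neg \<phi>) \<longleftrightarrow> arithmetical \<phi>"
| "arithmetical (Conj \<phi> \<psi>) \<longleftrightarrow> arithmetical \<phi> \<and> arithmetical \<psi>"
| "arithmetical (ExN \<phi>) \<longleftrightarrow> arithmetical \<phi>"
| "arithmetical (AllN \<phi>) \<longleftrightarrow> arithmetical \<phi>"
| "arithmetical (ExF \<phi>) \<longleftrightarrow> False"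
| "arithmetical (AllF \<phi>) \<longleftrightarrow> False"

fun is_Sigma1 :: "nat \<Rightarrow> fm \<Rightarrow> bool" and is_Pi1 :: "nat \<Rightarrow> fm \<Rightarrow> bool" where
  "is_Sigma1 0 \<phi> \<longleftrightarrow> arithmetical \<phi>"
| "is_Sigma1 (Suc k) \<phi> \<longleftrightarrow> (\<exists>\<psi>. \<phi> = ExF \<psi> \<and> is_Pi1 k \<psi>)"
| "is_Pi1 0 \<phi> \<longleftrightarrow> arithmetical \<phi>"
| "is_Pi1 (Suc k) \<phi> \<longleftrightarrow> (\<exists>\<psi>. \<phi> = AllF \<psi> \<and> is_Sigma1 k \<psi>)"

primrec tm_code :: "tm \<Rightarrow> nat" where
  "tm_code (NVar i) = list_encode [0, i]"
| "tm_code Zero = list_encode [1]"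
| "tm_code (Succ t) = list_encode [2, tm_code t]"
| "tm_code (Plus s t) = list_encode [3, tm_code s, tm_code t]"
| "tm_code (Times s t) = list_encode [4, tm_code s, tm_code t]"
| "tm_code (FApp i t) = list_encode [5, i, tm_code t]"

primrec fm_code :: "fm \<Rightarrow> nat" where
  "fm_code (Eq s t) = list_encode [0, tm_code s, tm_code t]"
| "fm_code (Neg \<phi>) = list_encode [1, fm_code \<phi>]"
| "fm_code (Conj \<phi> \<psi>) = list_encode [2, fm_code \<phi>, fm_code \<psi>]"
| "fm_code (ExN \<phi>) = list_encode [3, fm_code \<phi>]"
| "fm_code (AllN \<phi>) = list_encode [4, fm_code \<phi>]"
| "fm_code (ExF \<phi>) = list_encode [5, fm_code \<phi>]"
| "fm_code (AllF \<phi>) = list_encode [6, fm_code \<phi>]"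

text \<open>The input \<open>h\<close> carries a formula code \<open>h 0\<close>, number parameters at the odd arguments and
  function parameters at the positive even arguments. As for \<open>\<exists>\<^sup>2\<close>, the value 0 means true.\<close>

definition S2_functional :: "nat \<Rightarrow> tp2" where
  "S2_functional k h =
    (if \<exists>\<phi>. fm_code \<phi> = h 0 \<and> is_Sigma1 k \<phi> \<and>
           fm_true (\<lambda>i. h (2 * i + 1)) (\<lambda>i n. h (2 * prod_encode (i, n) + 2)) \<phi>
     then 0 else 1)"

section \<open>Representations by objects of finite type\<close>

definition rat_of_code :: "nat \<Rightarrow> rat" where
  "rat_of_code c = (case prod_decode c of (a, b) \<Rightarrow> Fract (int_decode a) (int b + 1))"

text \<open>A real is represented by any fast-converging Cauchy sequence of rationals, and a function
  on the reals by any functional on type-1 objects that maps representations to representations.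
  A functional \<open>tp1 \<Rightarrow> tp1\<close> is given as the type-2 object taking \<open>case_nat n g\<close> to the
  \<open>n\<close>-th value of the result at \<open>g\<close>.\<close>

definition real_name :: "tp1 \<Rightarrow> real \<Rightarrow> bool" where
  "real_name g x \<longleftrightarrow>
    (\<forall>n i. \<bar>rat_of_code (g n) - rat_of_code (g (n + i))\<bar> < 1 / 2 ^ n) \<and>
    (\<lambda>n. real_of_rat (rat_of_code (g n))) \<longlonglongrightarrow> x"

definition rat_pair_name :: "tp1 \<Rightarrow> rat \<times> rat \<Rightarrow> bool" where
  "rat_pair_name g z \<longleftrightarrow> map_prod rat_of_code rat_of_code (prod_decode (g 0)) = z"

definition nat_arg :: "obj list \<Rightarrow> nat \<Rightarrow> bool" where
  "nat_arg as n \<longleftrightarrow> as = [O0 n]"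

definition real_arg :: "obj list \<Rightarrow> real \<Rightarrow> bool" where
  "real_arg as x \<longleftrightarrow> (\<exists>g. as = [O1 g] \<and> real_name g x)"

definition rfun_arg :: "obj list \<Rightarrow> (real \<Rightarrow> real) \<Rightarrow> bool" where
  "rfun_arg as f \<longleftrightarrow>
    (\<exists>F. as = [O2 F] \<and> (\<forall>g x. real_name g x \<longrightarrow> real_name (\<lambda>n. F (case_nat n g)) (f x)))"

definition rnat_arg :: "obj list \<Rightarrow> (real \<Rightarrow> nat) \<Rightarrow> bool" where
  "rnat_arg as Y \<longleftrightarrow> (\<exists>F. as = [O2 F] \<and> (\<forall>g x. real_name g x \<longrightarrow> F g = Y x))"

definition rset_arg :: "obj list \<Rightarrow> real set \<Rightarrow> bool" where
  "rset_arg as A \<longleftrightarrow> rnat_arg as (indicator A)"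

definition pair_arg ::
  "(obj list \<Rightarrow> 'a \<Rightarrow> bool) \<Rightarrow> (obj list \<Rightarrow> 'b \<Rightarrow> bool) \<Rightarrow> obj list \<Rightarrow> 'a \<times> 'b \<Rightarrow> bool"
  (infixr "\<otimes>\<^sub>a" 70) where
  "(R \<otimes>\<^sub>a Q) as z \<longleftrightarrow> (\<exists>bs cs. as = bs @ cs \<and> R bs (fst z) \<and> Q cs (snd z))"

text \<open>A functional \<open>\<Phi>\<close> is computable in the lists of oracles in \<open>\<Omega>\<close> if a single index works for each
  of them; \<open>\<Omega>\<close> is the set of all presentations of the oracle as objects of pure type.\<close>

definition computable_in ::
  "obj list set \<Rightarrow> (obj list \<Rightarrow> 'a \<Rightarrow> bool) \<Rightarrow> (tp1 \<Rightarrow> 'b \<Rightarrow> bool) \<Rightarrow> ('a \<Rightarrow> 'b) \<Rightarrow> bool" where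
  "computable_in \<Omega> arg out \<Phi> \<longleftrightarrow>
    (\<exists>e. \<forall>os\<in>\<Omega>. \<forall>as x. arg as x \<longrightarrow>
      (\<exists>g. out g (\<Phi> x) \<and> (\<forall>n. kleene e (os @ as @ [O0 n]) (g n))))"

text \<open>Coding of finitely many arguments of type at most 2 as a single type-2 object.
  The \<open>O3\<close> case does not occur.\<close>

primrec as_tp2 :: "obj \<Rightarrow> tp2" where
  "as_tp2 (O0 n) = (\<lambda>h. n)"
| "as_tp2 (O1 g) = (\<lambda>h. g (h 0))"
| "as_tp2 (O2 F) = F"
| "as_tp2 (O3 G) = (\<lambda>h. 0)"

definition tuple :: "obj list \<Rightarrow> tp2" where
  "tuple as h = (if h 0 < length as then as_tp2 (as ! h 0) (\<lambda>i. h (Suc i)) else 0)"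

definition presents ::
  "(obj list \<Rightarrow> 'a \<Rightarrow> bool) \<Rightarrow> (tp1 \<Rightarrow> 'b \<Rightarrow> bool) \<Rightarrow> tp3 \<Rightarrow> ('a \<Rightarrow> 'b) \<Rightarrow> bool" where
  "presents arg out G \<Phi> \<longleftrightarrow> (\<forall>as x. arg as x \<longrightarrow> out (\<lambda>n. G (tuple (as @ [O0 n]))) (\<Phi> x))"

section \<open>Semi-continuity, oscillation, Cantor realisers\<close>

text \<open>A function \<open>[0,1] \<rightarrow> [0,1]\<close> is a function on the reals of which only the restriction
  to \<open>[0,1]\<close> is considered; all topological notions are relative to \<open>[0,1]\<close>.\<close>

definition usco_at :: "(real \<Rightarrow> real) \<Rightarrow> real \<Rightarrow> bool" where
  "usco_at f x \<longleftrightarrow> (\<forall>y > f x. \<exists>N::nat. \<forall>z \<in> ball x (1 / 2 ^ N) \<inter> {0..1}. f z < y)"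

definition usco01 :: "(real \<Rightarrow> real) \<Rightarrow> bool" where
  "usco01 f \<longleftrightarrow> f \<in> {0..1} \<rightarrow> {0..1} \<and> (\<forall>x\<in>{0..1}. usco_at f x)"

definition cont_points :: "(real \<Rightarrow> real) \<Rightarrow> real set" where
  "cont_points f = {x \<in> {0..1}. continuous (at x within {0..1}) f}"

definition osc_on :: "(real \<Rightarrow> real) \<Rightarrow> real set \<Rightarrow> real" where
  "osc_on f X = Sup (f ` X) - Inf (f ` X)"

definition osc :: "(real \<Rightarrow> real) \<Rightarrow> real \<Rightarrow> real" where
  "osc f x = lim (\<lambda>k. osc_on f (ball x (1 / 2 ^ k) \<inter> {0..1}))"

definition is_osc01 :: "(real \<Rightarrow> real) \<Rightarrow> (real \<Rightarrow> real) \<Rightarrow> bool" where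
  "is_osc01 w f \<longleftrightarrow> (\<forall>x\<in>{0..1}. w x = osc f x)"

text \<open>The value has to lie in \<open>[0,1]\<close>: otherwise the constant 2 would be a Cantor realiser.\<close>

definition cantor_realiser :: "(real set \<times> (real \<Rightarrow> nat) \<Rightarrow> real) \<Rightarrow> bool" where
  "cantor_realiser \<Gamma> \<longleftrightarrow>
    (\<forall>A Y. A \<subseteq> {0..1} \<longrightarrow> A \<noteq> {} \<longrightarrow> inj_on Y A \<longrightarrow> \<Gamma> (A, Y) \<in> {0..1} - A)"

definition computable_in_S2 ::
  "nat \<Rightarrow> (obj list \<Rightarrow> 'a \<Rightarrow> bool) \<Rightarrow> (tp1 \<Rightarrow> 'b \<Rightarrow> bool) \<Rightarrow> ('a \<Rightarrow> 'b) \<Rightarrow> bool" where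
  "computable_in_S2 k arg out \<Phi> \<longleftrightarrow> computable_in {[O2 (S2_functional k)]} arg out \<Phi>"

definition computes_cantor_realiser ::
  "(obj list \<Rightarrow> 'a \<Rightarrow> bool) \<Rightarrow> (tp1 \<Rightarrow> 'b \<Rightarrow> bool) \<Rightarrow> ('a \<Rightarrow> 'b) \<Rightarrow> bool" where
  "computes_cantor_realiser arg out \<Phi> \<longleftrightarrow>
    (\<exists>\<Gamma>. cantor_realiser \<Gamma> \<and>
      computable_in {[O3 G, O2 E2] | G. presents arg out G \<Phi>} (rset_arg \<otimes>\<^sub>a rnat_arg) real_name \<Gamma>)"

end

theory Submission
  imports Defs
begin

text \<open>
  For \<open>Y\<close> injective on \<open>A\<close>, the function \<open>spikes A Y\<close> with value \<open>1 / (Y x + 1)\<close> at \<open>x \<in> A\<close> and \<open>0\<close>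
  elsewhere tends to \<open>0\<close> at every point. Hence it is upper semi-continuous, equals its own
  oscillation function, and is continuous exactly outside \<open>A\<close>. A point of continuity is thus a
  value of a Cantor realiser; from suprema, or from a \<open>G\<^sub>\<delta>\<close>-code of the set of continuity points,
  such a point is found by nested dyadic intervals, where the next interval is the one with least
  code that is small enough for the given supremum, or contained in the given open set. The search
  is made total and independent of the presentation by deciding its conditions with \<open>\<exists>\<^sup>2\<close>.

  Non-computability holds relative to any type-2 functional. A computation from type-2 arguments is
  a well-founded, countably branching tree, and the values of the partial functional given by a
  partial assignment of indices to reals only grow with the assignment. By Zorn's lemma there is a
  maximal assignment in which each real is assigned an index that computes it from the assignment
  itself. It is injective, since an index computes at most one real, and its domain \<open>A\<close> contains
  every real computable from it. So no algorithm finds a point outside \<open>A\<close> from \<open>spikes A Y\<close>. This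
  replaces the usual appeal to Gandy selection.
\<close>

section \<open>Spike functions\<close>

definition spikes :: "real set \<Rightarrow> (real \<Rightarrow> nat) \<Rightarrow> real \<Rightarrow> real" where
  "spikes A Y x = (if x \<in> A then 1 / real (Suc (Y x)) else 0)"

lemma spikes_range: "0 \<le> spikes A Y x" "spikes A Y x \<le> 1"
  by (simp_all add: spikes_def divide_le_eq)

lemma spikes_eq_0_iff: "spikes A Y x = 0 \<longleftrightarrow> x \<notin> A"
  by (simp add: spikes_def)

text \<open>Injectivity leaves only finitely many points of \<open>A\<close> with
  \<open>Y z \<le> N\<close>. A punctured neighbourhood avoiding them sees spikes of height below
  \<open>1 / (N + 1)\<close> only.\<close>

lemma spikes_small_near:
  assumes "inj_on Y A" "\<epsilon> > 0"
  shows "\<exists>\<delta>>0. \<forall>z. z \<noteq> x \<longrightarrow> dist z x < \<delta> \<longrightarrow> spikes A Y z < \<epsilon>"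
proof -
  obtain N where N: "1 / real (Suc N) < \<epsilon>"
    using assms(2) nat_approx_posE by blast
  have "finite (Y ` {z \<in> A. Y z \<le> N})"
    by (rule finite_subset[of _ "{..N}"]) auto
  then have fin: "finite {z \<in> A. Y z \<le> N}"
    by (rule finite_imageD) (use assms(1) in \<open>auto intro: inj_on_subset\<close>)
  obtain \<delta> where \<delta>: "\<delta> > 0" "\<forall>z\<in>{z \<in> A. Y z \<le> N}. z \<noteq> x \<longrightarrow> \<delta> \<le> dist x z"
    using finite_set_avoid[OF fin] by blast
  have "spikes A Y z < \<epsilon>" if "z \<noteq> x" "dist z x < \<delta>" for z
  proof (cases "z \<in> A")
    case True
    with \<delta>(2) that have "N < Y z"
      by (force simp: dist_commute)
    then have "1 / real (Suc (Y z)) \<le> 1 / real (Suc N)"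
      by (intro divide_left_mono) auto
    with True N show ?thesis by (simp add: spikes_def)
  qed (use assms(2) in \<open>simp add: spikes_def\<close>)
  with \<delta>(1) show ?thesis by blast
qed

text \<open>Adding the value at \<open>x\<close> covers the centre of the ball. The bound holds for
  all \<open>k \<ge> N\<close>: upper semi-continuity takes one \<open>k\<close>, the limit defining
  \<open>osc\<close> takes all of them.\<close>

lemma spikes_near_le:
  assumes "inj_on Y A" "\<epsilon> > 0"
  shows "\<exists>N::nat. \<forall>k\<ge>N. \<forall>z\<in>ball x (1 / 2 ^ k). spikes A Y z < spikes A Y x + \<epsilon>"
proof -
  obtain \<delta> where \<delta>: "\<delta> > 0" "\<And>z. z \<noteq> x \<Longrightarrow> dist z x < \<delta> \<Longrightarrow> spikes A Y z < \<epsilon>"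
    using spikes_small_near[OF assms] by blast
  obtain N where N: "(1 / 2) ^ N < \<delta>"
    using real_arch_pow_inv[OF \<delta>(1), of "1/2"] by auto
  have "spikes A Y z < spikes A Y x + \<epsilon>" if "k \<ge> N" "z \<in> ball x (1 / 2 ^ k)" for k z
  proof (cases "z = x")
    case False
    have "(1 / 2 :: real) ^ k \<le> (1 / 2) ^ N"
      using that(1) by (intro power_decreasing) auto
    with that(2) N have "dist z x < \<delta>"
      by (simp add: power_one_over dist_commute)
    from \<delta>(2)[OF False this] show ?thesis
      using spikes_range(1)[of A Y x] by linarith
  qed (use assms in simp)
  then show ?thesis by blast
qed

lemma islimpt_unit_interval: "x \<in> {0..1::real} \<Longrightarrow> x islimpt {0..1}"
  by (simp add: islimpt_Icc)

lemma spikes_tendsto_0: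
  assumes "inj_on Y A"
  shows "(spikes A Y \<longlongrightarrow> 0) (at x within X)"
  unfolding tendsto_iff eventually_at
proof (intro allI impI)
  fix \<epsilon> :: real assume "\<epsilon> > 0"
  then obtain \<delta> where "\<delta> > 0" "\<And>z. z \<noteq> x \<Longrightarrow> dist z x < \<delta> \<Longrightarrow> spikes A Y z < \<epsilon>"
    using spikes_small_near[OF assms] by blast
  then show "\<exists>d>0. \<forall>xa\<in>X. xa \<noteq> x \<and> dist xa x < d \<longrightarrow> dist (spikes A Y xa) 0 < \<epsilon>"
    using spikes_range(1)[of A Y] by (auto intro!: exI[of _ \<delta>])
qed

lemma usco01_spikes:
  assumes "inj_on Y A"
  shows "usco01 (spikes A Y)"
  unfolding usco01_def usco_at_def
proof (intro conjI ballI allI impI)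
  fix x y assume "spikes A Y x < y"
  then show "\<exists>N. \<forall>z\<in>ball x (1 / 2 ^ N) \<inter> {0..1}. spikes A Y z < y"
    using spikes_near_le[OF assms, of "y - spikes A Y x" x] by fastforce
qed (use spikes_range in auto)

text \<open>The limit at every point is 0, and it is unique because the unit interval has no
  isolated points, so continuity amounts to value 0.\<close>

lemma cont_points_spikes:
  assumes "inj_on Y A"
  shows "cont_points (spikes A Y) = {0..1} - A"
proof -
  have "continuous (at x within {0..1}) (spikes A Y) \<longleftrightarrow> x \<notin> A" if "x \<in> {0..1}" for x
  proof -
    have "at x within {0..1} \<noteq> bot"
      using islimpt_unit_interval[OF that] by (simp add: trivial_limit_within)
    then have "continuous (at x within {0..1}) (spikes A Y) \<longleftrightarrow> spikes A Y x = 0"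
      unfolding continuous_within
      using spikes_tendsto_0[OF assms, of x "{0..1}"] tendsto_unique by metis
    then show ?thesis by (simp add: spikes_eq_0_iff)
  qed
  then show ?thesis by (auto simp: cont_points_def)
qed

lemma osc_spikes:
  assumes "inj_on Y A" "x \<in> {0..1}"
  shows "osc (spikes A Y) x = spikes A Y x"
proof -
  let ?f = "spikes A Y" and ?B = "\<lambda>k. ball x (1 / 2 ^ k) \<inter> {0..1}"
  have ne: "x \<in> ?B k" for k using assms(2) by simp
  have bdd: "bdd_above (?f ` ?B k)" "bdd_below (?f ` ?B k)" for k
    by (auto intro!: bdd_aboveI[of _ 1] bdd_belowI[of _ 0] simp: spikes_range)
  \<comment> \<open>Every ball contains points other than \<open>x\<close> arbitrarily close to
    \<open>x\<close>, and the values there tend to 0. Only the supremum contributes to the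
    oscillation.\<close>
  have Inf: "Inf (?f ` ?B k) = 0" for k
  proof (rule antisym)
    show "Inf (?f ` ?B k) \<le> 0"
    proof (rule field_le_epsilon)
      fix \<epsilon> :: real assume "\<epsilon> > 0"
      then obtain \<delta> where \<delta>: "\<delta> > 0" "\<And>z. z \<noteq> x \<Longrightarrow> dist z x < \<delta> \<Longrightarrow> ?f z < \<epsilon>"
        using spikes_small_near[OF assms(1)] by blast
      obtain z where z: "z \<in> {0..1}" "z \<noteq> x" "dist z x < min \<delta> (1 / 2 ^ k)"
        using islimpt_unit_interval[OF assms(2)] \<delta>(1) unfolding islimpt_approachable
        by (metis min_less_iff_conj zero_less_divide_1_iff zero_less_numeral zero_less_power)
      then have "Inf (?f ` ?B k) \<le> ?f z"
        by (intro cInf_lower bdd imageI) (auto simp: dist_commute)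
      also have "\<dots> \<le> 0 + \<epsilon>" using \<delta>(2)[of z] z by simp
      finally show "Inf (?f ` ?B k) \<le> 0 + \<epsilon>" .
    qed
    show "0 \<le> Inf (?f ` ?B k)"
      using ne[of k] by (intro cInf_greatest) (blast, auto simp: spikes_range)
  qed
  have Sup_ge: "?f x \<le> Sup (?f ` ?B k)" for k
    using ne[of k] bdd by (intro cSup_upper imageI)
  have "(\<lambda>k. osc_on ?f (?B k)) \<longlonglongrightarrow> ?f x"
  proof (rule metric_LIMSEQ_I)
    fix \<epsilon> :: real assume "\<epsilon> > 0"
    then obtain N where N: "\<And>k z. k \<ge> N \<Longrightarrow> z \<in> ball x (1 / 2 ^ k) \<Longrightarrow> ?f z < ?f x + \<epsilon> / 2"
      using spikes_near_le[OF assms(1), of "\<epsilon> / 2" x] by (meson half_gt_zero)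
    have "dist (osc_on ?f (?B k)) (?f x) < \<epsilon>" if "k \<ge> N" for k
    proof -
      have "Sup (?f ` ?B k) \<le> ?f x + \<epsilon> / 2"
        using ne[of k] N[OF that] by (intro cSup_least) (force intro: less_imp_le)+
      with Sup_ge[of k] \<open>\<epsilon> > 0\<close> show ?thesis
        by (simp add: osc_on_def Inf dist_real_def)
    qed
    then show "\<exists>N. \<forall>k\<ge>N. dist (osc_on ?f (?B k)) (?f x) < \<epsilon>" by blast
  qed
  then show ?thesis unfolding osc_def by (rule limI)
qed

lemma is_osc01_spikes: "inj_on Y A \<Longrightarrow> is_osc01 (spikes A Y) (spikes A Y)"
  by (simp add: is_osc01_def osc_spikes)

section \<open>Names of spike functions\<close>

text \<open>In a presentation of a real function, entry 0 of the input is the requested precision;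
  the tail is the name of the argument.\<close>

definition tail :: "tp1 \<Rightarrow> tp1" where
  "tail h = (\<lambda>i. h (Suc i))"

lemma tail_case_nat [simp]: "tail (case_nat n g) = g"
  by (simp add: tail_def)

lemma real_name_unique: "real_name g x \<Longrightarrow> real_name g y \<Longrightarrow> x = y"
  unfolding real_name_def using LIMSEQ_unique by blast

lemma real_name_const: "real_name (\<lambda>n. c) (real_of_rat (rat_of_code c))"
  by (simp add: real_name_def)

text \<open>The precision \<open>h 0\<close> is not consulted, since the value is a rational and has
  a constant name. Code \<open>prod_encode (2, y)\<close> is \<open>1 / (y + 1)\<close> because
  \<open>int_decode 2 = 1\<close>.\<close>

definition spikes_rep :: "tp2 \<Rightarrow> tp2 \<Rightarrow> tp2" where
  "spikes_rep FA FY h = (if FA (tail h) = 0 then 0 else prod_encode (2, FY (tail h)))"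

lemma rat_of_code_0: "rat_of_code 0 = 0"
proof -
  have "prod_decode 0 = (0, 0)"
    by (simp add: prod_decode_def prod_decode_aux.simps)
  then show ?thesis
    by (simp add: rat_of_code_def int_decode_def sum_decode_def rat_number_collapse)
qed

lemma rat_of_code_even:
  "rat_of_code (prod_encode (2 * a, b)) = of_nat a / of_nat (Suc b)"
  by (simp add: rat_of_code_def int_decode_def sum_decode_def Fract_of_int_quotient)

lemma real_name_spikes_rep:
  assumes "FA g = indicator A x" "FY g = Y x"
  shows "real_name (\<lambda>n. spikes_rep FA FY (case_nat n g)) (spikes A Y x)"
proof -
  have "rat_of_code (prod_encode (2, Y x)) = 1 / of_nat (Suc (Y x))"
    using rat_of_code_even[of 1 "Y x"] by simp
  then have "real_of_rat (rat_of_code (spikes_rep FA FY (case_nat n g))) = spikes A Y x" for n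
    using assms by (simp add: spikes_rep_def spikes_def rat_of_code_0 of_rat_divide of_rat_add)
  with real_name_const[of "spikes_rep FA FY (case_nat 0 g)"] show ?thesis
    by (simp add: spikes_rep_def cong: if_cong)
qed

section \<open>Computations relative to a partial functional\<close>

declare list_encode.simps [simp del] list_encode_eq [simp]

text \<open>Symbolic arguments: \<open>Fix\<close> stands for the given total functional, \<open>Var\<close> for the partial
  functional under construction and \<open>Fn j\<close> for the \<open>j\<close>-th of a list of function parameters. With them,
  argument lists form a countable type.\<close>

datatype sym = Num nat | Fn nat | Fix | Var

instance sym :: countable by countable_datatype

text \<open>S1-S9 on symbolic lists. Applying \<open>Var\<close> requires \<open>V\<close> to be
  defined at the computed function, so undefinedness spreads to everything that depends on it;
  \<open>Fix\<close> is total.\<close>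

inductive pkleene :: "(nat \<Rightarrow> tp1) \<Rightarrow> tp2 \<Rightarrow> (tp1 \<rightharpoonup> nat) \<Rightarrow> nat \<Rightarrow> sym list \<Rightarrow> nat \<Rightarrow> bool"
  for v :: "nat \<Rightarrow> tp1" and H :: tp2 and V :: "tp1 \<rightharpoonup> nat" where
  "pkleene v H V (list_encode [1]) (Num x # as) (Suc x)"
| "pkleene v H V (list_encode [2, q]) as q"
| "pkleene v H V (list_encode [3]) (Num x # as) x"
| "pkleene v H V b as x \<Longrightarrow> pkleene v H V d (Num x # as) y \<Longrightarrow>
    pkleene v H V (list_encode [4, d, b]) as y"
| "pkleene v H V b as y \<Longrightarrow> pkleene v H V (list_encode [5, b, d]) (Num 0 # as) y"
| "pkleene v H V (list_encode [5, b, d]) (Num x # as) z \<Longrightarrow>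
    pkleene v H V d (Num x # Num z # as) y \<Longrightarrow>
    pkleene v H V (list_encode [5, b, d]) (Num (Suc x) # as) y"
| "i < length as \<Longrightarrow> pkleene v H V d (as ! i # take i as @ drop (Suc i) as) y \<Longrightarrow>
    pkleene v H V (list_encode [6, d, i]) as y"
| "pkleene v H V (list_encode [7]) (Fn j # Num x # as) (v j x)"
| "(\<And>x. pkleene v H V d (Num x # Fix # as) (h x)) \<Longrightarrow>
    pkleene v H V (list_encode [8, d]) (Fix # as) (H h)"
| "(\<And>x. pkleene v H V d (Num x # Var # as) (h x)) \<Longrightarrow> V h = Some y \<Longrightarrow>
    pkleene v H V (list_encode [8, d]) (Var # as) y"
| "m \<le> length as \<Longrightarrow> pkleene v H V x (take m as) y \<Longrightarrow>
    pkleene v H V (list_encode [9, m]) (Num x # as) y"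

text \<open>\<open>V\<close> enters only through the positive premise \<open>V h = Some y\<close> of
  S8 for \<open>Var\<close>.\<close>

lemma pkleene_mono:
  assumes "pkleene v H V e as y" "V \<subseteq>\<^sub>m W"
  shows "pkleene v H W e as y"
  using assms(1)
proof induction
  case (10 d as h y)
  then have "W h = Some y" using assms(2) by (metis domI map_le_def)
  with 10 show ?case by (blast intro: pkleene.intros)
qed (blast intro: pkleene.intros)+

inductive_cases pkleene_elims:
  "pkleene v H V (list_encode [1]) as y"
  "pkleene v H V (list_encode [2, q]) as y"
  "pkleene v H V (list_encode [3]) as y"
  "pkleene v H V (list_encode [4, d, b]) as y"
  "pkleene v H V (list_encode [5, b, d]) (Num 0 # as) y"
  "pkleene v H V (list_encode [5, b, d]) (Num (Suc x) # as) y"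
  "pkleene v H V (list_encode [6, d, i]) as y"
  "pkleene v H V (list_encode [7]) as y"
  "pkleene v H V (list_encode [8, d]) (Fix # as) y"
  "pkleene v H V (list_encode [8, d]) (Var # as) y"
  "pkleene v H V (list_encode [9, m]) as y"

text \<open>Index and argument list determine the rule applied. In the S8 cases the induction
  hypothesis gives equality of the oracle arguments at every number, hence as functions.\<close>

lemma pkleene_functional:
  assumes "pkleene v H V e as y" "pkleene v H V e as z"
  shows "y = z"
  using assms
proof (induction arbitrary: z)
  case (1 x as)
  then show ?case by (rule pkleene_elims(1)) simp
next
  case (2 q as)
  then show ?case by (rule pkleene_elims(2)) simp
next
  case (3 x as)
  then show ?case by (rule pkleene_elims(3)) simp
next
  case (4 b as x d y)
  from 4(5) obtain x' where "pkleene v H V b as x'" "pkleene v H V d (Num x' # as) z"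
    by (rule pkleene_elims(4))
  then show ?case using 4(3)[of x'] 4(4)[of z] by simp
next
  case (5 b as y d)
  from 5(3) show ?case by (rule pkleene_elims(5)) (rule 5(2))
next
  case (6 b d x as z' y)
  from 6(5) obtain z'' where "pkleene v H V (list_encode [5, b, d]) (Num x # as) z''"
      "pkleene v H V d (Num x # Num z'' # as) z"
    by (rule pkleene_elims(6))
  then show ?case using 6(3)[of z''] 6(4)[of z] by simp
next
  case (7 i as d y)
  from 7(4) show ?case by (rule pkleene_elims(7)) (rule 7(3))
next
  case (8 j x as)
  then show ?case by (rule pkleene_elims(8)) simp
next
  case (9 d as h)
  from 9(3) show ?case
  proof (rule pkleene_elims(9))
    fix h' assume h': "z = H h'" "\<And>x. pkleene v H V d (Num x # Fix # as) (h' x)"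
    then have "h = h'" using 9(2) by blast
    with h' show ?case by simp
  qed
next
  case (10 d as h y)
  from 10(4) show ?case
  proof (rule pkleene_elims(10))
    fix h' assume h': "V h' = Some z" "\<And>x. pkleene v H V d (Num x # Var # as) (h' x)"
    then have "h = h'" using 10(3) by blast
    with h' 10 show ?case by simp
  qed
next
  case (11 m as x y)
  from 11(4) show ?case by (rule pkleene_elims(11)) (use 11(3) in simp)
qed

primrec interp :: "(nat \<Rightarrow> tp1) \<Rightarrow> tp2 \<Rightarrow> tp2 \<Rightarrow> sym \<Rightarrow> obj" where
  "interp v H F (Num n) = O0 n"
| "interp v H F (Fn j) = O1 (v j)"
| "interp v H F Fix = O2 H"
| "interp v H F Var = O2 F"

lemma interp_eq_iff:
  "O0 n = interp v H F s \<longleftrightarrow> s = Num n"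
  "O1 g = interp v H F s \<longleftrightarrow> (\<exists>j. s = Fn j \<and> g = v j)"
  "O2 K = interp v H F s \<longleftrightarrow> s = Fix \<and> K = H \<or> s = Var \<and> K = F"
  "O3 G \<noteq> interp v H F s"
  by (cases s; auto)+

text \<open>By induction, each subcomputation is also one relative to \<open>V\<close>: when
  \<open>Var\<close> is applied to a function, that function is already computed relative to
  \<open>V\<close>, and closedness makes \<open>V\<close> agree with \<open>F\<close> there. Type-3
  entries never arise from symbols.\<close>

lemma pkleene_of_kleene:
  assumes closed: "\<And>d as h. (\<And>x. pkleene v H V d (Num x # Var # as) (h x)) \<Longrightarrow> V h = Some (F h)"
    and "kleene e os y" "os = map (interp v H F) as"
  shows "pkleene v H V e as y"
proof -
  \<comment> \<open>The value is abstracted to \<open>z\<close>: a conclusion about \<open>K h\<close>, as in S8, would leave a flexible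
    application to unification.\<close>
  have "pkleene v H V e as z" if "os = map (interp v H F) as" "z = y" for as z
    using assms(2) that
  proof (induction arbitrary: as z)
    case (S1 x os)
    then obtain as' where "as = Num x # as'"
      by (auto simp: Cons_eq_map_conv interp_eq_iff)
    then show ?case using S1 by (simp only: pkleene.intros)
  next
    case (S2 q os)
    then show ?case by (simp only: pkleene.intros)
  next
    case (S3 x os)
    then obtain as' where "as = Num x # as'"
      by (auto simp: Cons_eq_map_conv interp_eq_iff)
    then show ?case using S3 by (simp only: pkleene.intros)
  next
    case (S4 b os x d y)
    then have "pkleene v H V b as x" "pkleene v H V d (Num x # as) z" by simp_all
    then show ?case by (rule pkleene.intros)
  next
    case (S5_0 b os y d)
    then obtain as' where as': "as = Num 0 # as'" "os = map (interp v H F) as'"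
      by (auto simp: Cons_eq_map_conv interp_eq_iff)
    with S5_0 have "pkleene v H V b as' z" by simp
    then show ?case unfolding as' by (rule pkleene.intros)
  next
    case (S5_Suc b d x os z' y)
    then obtain as' where as': "as = Num (Suc x) # as'" "os = map (interp v H F) as'"
      by (auto simp: Cons_eq_map_conv interp_eq_iff)
    with S5_Suc have "pkleene v H V (list_encode [5, b, d]) (Num x # as') z'"
      "pkleene v H V d (Num x # Num z' # as') z"
      by simp_all
    then show ?case unfolding as' by (rule pkleene.intros)
  next
    case (S6 i os d y)
    then have "i < length as" "pkleene v H V d (as ! i # take i as @ drop (Suc i) as) z"
      by (simp_all add: take_map drop_map)
    then show ?case by (rule pkleene.intros)
  next
    case (S7 f x os)
    then obtain j as' where "as = Fn j # Num x # as'" "f = v j"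
      by (auto simp: Cons_eq_map_conv interp_eq_iff)
    then show ?case using S7 by (simp only: pkleene.intros)
  next
    case (S8_2 d K os h)
    from S8_2.prems obtain s as'
      where as: "as = s # as'" "os = map (interp v H F) as'" "O2 K = interp v H F s"
      by (auto simp: Cons_eq_map_conv)
    then have *: "pkleene v H V d (Num x # s # as') (h x)" for x
      using S8_2.IH by simp
    consider "s = Fix" "K = H" | "s = Var" "K = F"
      using as(3) by (auto simp: interp_eq_iff)
    then show ?case
    proof cases
      case 1
      then show ?thesis
        using * pkleene.intros(9)[of v H V d as' h] as(1) S8_2.prems(2) by simp
    next
      case 2
      then have "V h = Some (F h)" using * closed[of d as' h] by simp
      with 2 show ?thesis
        using * pkleene.intros(10)[of v H V d as' h] as(1) S8_2.prems(2) by simp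
    qed
  next
    case (S8_3 d G os h)
    from S8_3.prems show ?case by (auto simp: Cons_eq_map_conv interp_eq_iff)
  next
    case (S9 m os x y)
    then obtain as' where as': "as = Num x # as'" "os = map (interp v H F) as'"
      by (auto simp: Cons_eq_map_conv interp_eq_iff)
    then have "m \<le> length as'" "pkleene v H V x (take m as') z"
      using S9 by (simp_all add: take_map)
    then show ?case unfolding as' by (rule pkleene.intros)
  qed
  then show ?thesis using assms(3) by blast
qed

text \<open>An index \<open>Inl (d, as)\<close> denotes the real named by the function to which the variable functional
  is applied when \<open>d\<close> is used in scheme S8; an index \<open>Inr d\<close> denotes the real that \<open>R\<close> extracts from
  the values of \<open>d\<close> at the argument lists \<open>P n\<close>.\<close>

type_synonym index = "nat \<times> sym list + nat"

primrec denotes ::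
  "(nat \<Rightarrow> tp1) \<Rightarrow> tp2 \<Rightarrow> (nat \<Rightarrow> sym list) \<Rightarrow> (tp1 \<Rightarrow> real) \<Rightarrow> (tp1 \<rightharpoonup> nat) \<Rightarrow> index \<Rightarrow> real \<Rightarrow> bool" where
  "denotes v H P R V (Inl da) x \<longleftrightarrow>
    (\<exists>h. (\<forall>n. pkleene v H V (fst da) (Num n # Var # snd da) (h n)) \<and> real_name (tail h) x)"
| "denotes v H P R V (Inr d) x \<longleftrightarrow> (\<exists>c. (\<forall>n. pkleene v H V d (P n) (c n)) \<and> x = R c)"

lemma denotes_mono: "denotes v H P R V i x \<Longrightarrow> V \<subseteq>\<^sub>m W \<Longrightarrow> denotes v H P R W i x"
  by (cases i) (auto intro: pkleene_mono)

lemma pkleene_fun_unique: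
  "(\<forall>n. pkleene v H V d (Q n) (g n)) \<Longrightarrow> (\<forall>n. pkleene v H V d (Q n) (h n)) \<Longrightarrow> g = h"
  using pkleene_functional by blast

text \<open>An index fixes the computed sequence, and a name fixes its real. This is the source of
  the injectivity of \<open>Y\<close> below.\<close>

lemma denotes_functional: "denotes v H P R V i x \<Longrightarrow> denotes v H P R V i y \<Longrightarrow> x = y"
proof (cases i)
  case (Inl da)
  assume "denotes v H P R V i x" "denotes v H P R V i y"
  then show ?thesis
    using pkleene_fun_unique[of v H V "fst da" "\<lambda>n. Num n # Var # snd da"] real_name_unique
    unfolding Inl denotes.simps by metis
next
  case (Inr d)
  assume "denotes v H P R V i x" "denotes v H P R V i y"
  then show ?thesis
    using pkleene_fun_unique[of v H V d P] by (auto simp: Inr)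
qed

section \<open>A maximal assignment of indices to reals\<close>

text \<open>The presentation of a spike function as far as \<open>S\<close> determines it. It is
  undefined exactly at names of reals that have no index yet, so that a later assignment can only
  extend it.\<close>

definition partial_spikes :: "(real \<times> index) set \<Rightarrow> tp1 \<rightharpoonup> nat" where
  "partial_spikes S h =
    (if \<nexists>x. real_name (tail h) x then Some 0
     else if \<exists>x i. real_name (tail h) x \<and> (x, i) \<in> S
       then Some (prod_encode (2, to_nat (THE i. \<exists>x. real_name (tail h) x \<and> (x, i) \<in> S)))
     else None)"

lemma partial_spikes_eq:
  assumes "single_valued S" "real_name (tail h) x" "(x, i) \<in> S"
  shows "partial_spikes S h = Some (prod_encode (2, to_nat i))"
proof -
  have "(THE i. \<exists>x. real_name (tail h) x \<and> (x, i) \<in> S) = i"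
    using assms by (intro the_equality) (auto dest: single_valuedD real_name_unique)
  with assms show ?thesis unfolding partial_spikes_def by auto
qed

text \<open>A name determines its real and a single-valued \<open>T\<close> determines the index, so
  values already defined do not change.\<close>

lemma partial_spikes_mono:
  assumes "single_valued T" "S \<subseteq> T"
  shows "partial_spikes S \<subseteq>\<^sub>m partial_spikes T"
proof -
  have "single_valued S" using assms single_valued_subset by blast
  have "partial_spikes S h = partial_spikes T h" if "h \<in> dom (partial_spikes S)" for h
  proof (cases "\<exists>x. real_name (tail h) x")
    case False
    then show ?thesis by (simp add: partial_spikes_def)
  next
    case True
    with that obtain x i where "real_name (tail h) x" "(x, i) \<in> S"
      by (auto simp: partial_spikes_def split: if_splits)
    then show ?thesis
      using assms \<open>single_valued S\<close> by (metis partial_spikes_eq subsetD)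
  qed
  then show ?thesis by (simp add: map_le_def)
qed

text \<open>Non-names get 0, which makes \<open>spikes_rep\<close> agree there with the default of
  \<open>partial_spikes\<close>.\<close>

definition name_mem :: "real set \<Rightarrow> tp2" where
  "name_mem A g = (if \<exists>x\<in>A. real_name g x then 1 else 0)"

definition name_value :: "(real \<Rightarrow> nat) \<Rightarrow> tp2" where
  "name_value Y g = Y (THE x. real_name g x)"

lemma name_value: "real_name g x \<Longrightarrow> name_value Y g = Y x"
  unfolding name_value_def by (metis real_name_unique the_equality)

lemma name_mem: "real_name g x \<Longrightarrow> name_mem A g = indicator A x"
  by (auto simp: name_mem_def dest: real_name_unique)

text \<open>\<open>P\<close> lists the queries made to a program and \<open>R\<close> decodes a real
  from the answers, so that one set \<open>A\<close> construction serves problems whose solutions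
  are not themselves reals.\<close>

lemma closed_spikes_exist:
  fixes v :: "nat \<Rightarrow> tp1" and H :: tp2 and P :: "nat \<Rightarrow> sym list" and R :: "tp1 \<Rightarrow> real"
  obtains A Y where "inj_on Y A"
    "\<And>e c. (\<And>n. kleene e (map (interp v H (spikes_rep (name_mem A) (name_value Y))) (P n)) (c n)) \<Longrightarrow>
      R c \<in> A"
proof -
  let ?den = "\<lambda>S. denotes v H P R (partial_spikes S)"
  \<comment> \<open>Each pair must be justified by the assignment it belongs to. Since denotation is
    monotone, unions of chains inherit this.\<close>
  define \<C> where "\<C> = {S. single_valued S \<and> (\<forall>(x, i)\<in>S. ?den S i x)}"
  have "\<exists>M\<in>\<C>. \<forall>X\<in>\<C>. M \<subseteq> X \<longrightarrow> X = M"
  proof (rule subset_Zorn_nonempty)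
    show "\<C> \<noteq> {}" by (auto simp: \<C>_def intro!: exI[of _ "{}"])
    fix C assume "C \<noteq> {}" and chain: "subset.chain \<C> C"
    have sv: "single_valued (\<Union>C)"
    proof (rule single_valuedI)
      fix x y z assume "(x, y) \<in> \<Union>C" "(x, z) \<in> \<Union>C"
      then obtain S T where ST: "S \<in> C" "T \<in> C" "(x, y) \<in> S" "(x, z) \<in> T" by blast
      then have "S \<subseteq> T \<or> T \<subseteq> S" using chain by (auto simp: subset_chain_def)
      moreover have "single_valued S" "single_valued T"
        using ST chain by (auto simp: subset_chain_def \<C>_def)
      ultimately show "y = z" using ST by (meson single_valuedD subsetD)
    qed
    have "?den (\<Union>C) i x" if "(x, i) \<in> S" "S \<in> C" for x i S
    proof -
      have "?den S i x" using that chain by (auto simp: subset_chain_def \<C>_def)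
      moreover have "S \<subseteq> \<Union>C" using that by blast
      ultimately show ?thesis using denotes_mono partial_spikes_mono[OF sv] by blast
    qed
    with sv show "\<Union>C \<in> \<C>" by (auto simp: \<C>_def)
  qed
  then obtain M where M: "M \<in> \<C>" and max: "\<And>X. X \<in> \<C> \<Longrightarrow> M \<subseteq> X \<Longrightarrow> X = M" by blast
  have sv: "single_valued M" and den: "\<And>x i. (x, i) \<in> M \<Longrightarrow> ?den M i x"
    using M by (auto simp: \<C>_def)
  \<comment> \<open>A denoted real without an index could be added together with \<open>i\<close>;
    old pairs stay justified by monotonicity, against maximality.\<close>
  have dom: "x \<in> Domain M" if "?den M i x" for i x
  proof (rule ccontr)
    assume x: "x \<notin> Domain M"
    let ?X = "insert (x, i) M"
    have sv': "single_valued ?X" using x sv by (auto simp: single_valued_def Domain_iff)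
    have "?den ?X j y" if "?den M j y" for j y
      using that denotes_mono partial_spikes_mono[OF sv', of M] by blast
    then have "?X \<in> \<C>" using sv' den \<open>?den M i x\<close> by (auto simp: \<C>_def)
    with max have "?X = M" by blast
    with x show False by blast
  qed
  define A where "A = Domain M"
  define Y where "Y x = to_nat (THE i. (x, i) \<in> M)" for x
  have Y: "Y x = to_nat i" if "(x, i) \<in> M" for x i
    unfolding Y_def using that sv by (metis single_valuedD the_equality)
  have inj: "inj_on Y A"
  proof (rule inj_onI)
    fix x y assume "x \<in> A" "y \<in> A" "Y x = Y y"
    then obtain i where "(x, i) \<in> M" "(y, i) \<in> M"
      using Y by (auto simp: A_def Domain_iff)
    then show "x = y" using den denotes_functional by blast
  qed
  let ?F = "spikes_rep (name_mem A) (name_value Y)"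
  \<comment> \<open>If the function given to \<open>Var\<close> carries a name, the index
    \<open>Inl (d, as)\<close> denotes the named real, which is therefore in the domain.\<close>
  have closed: "partial_spikes M h = Some (?F h)"
    if "\<And>x. pkleene v H (partial_spikes M) d (Num x # Var # as) (h x)" for d as h
  proof (cases "\<exists>x. real_name (tail h) x")
    case False
    then show ?thesis by (simp add: partial_spikes_def spikes_rep_def name_mem_def)
  next
    case True
    then obtain x where x: "real_name (tail h) x" by blast
    then have "?den M (Inl (d, as)) x" using that by auto
    then obtain i where i: "(x, i) \<in> M" using dom by blast
    then have "x \<in> A" by (auto simp: A_def)
    then show ?thesis
      using x i Y[OF i] partial_spikes_eq[OF sv x i]
      by (simp add: spikes_rep_def name_mem[OF x] name_value[OF x])
  qed
  have "R c \<in> A" if "\<And>n. kleene e (map (interp v H ?F) (P n)) (c n)" for e c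
  proof -
    have "pkleene v H (partial_spikes M) e (P n) (c n)" for n
      by (rule pkleene_of_kleene[OF _ that refl]) (rule closed)
    then have "?den M (Inr e) (R c)" by auto
    then show ?thesis unfolding A_def by (rule dom)
  qed
  with inj that show thesis by blast
qed

section \<open>Nested dyadic intervals\<close>

text \<open>Even codes stand for non-negative numerators, and denominators are stored minus
  one.\<close>

definition dyadic :: "nat \<Rightarrow> nat \<Rightarrow> nat" where
  "dyadic i k = prod_encode (2 * i, 2 ^ k - 1)"

text \<open>A pair code \<open>(i, k)\<close> stands for the dyadic cell from
  \<open>i / 2 ^ k\<close> to \<open>(i + 1) / 2 ^ k\<close>; \<open>lo\<close> and
  \<open>hi\<close> give codes of its end points.\<close>

definition lo :: "nat \<Rightarrow> nat" where
  "lo c = dyadic (fst (prod_decode c)) (snd (prod_decode c))"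

definition hi :: "nat \<Rightarrow> nat" where
  "hi c = dyadic (Suc (fst (prod_decode c))) (snd (prod_decode c))"

abbreviation real_of_code :: "nat \<Rightarrow> real" where
  "real_of_code c \<equiv> real_of_rat (rat_of_code c)"

lemma rat_of_code_dyadic: "rat_of_code (dyadic i k) = of_nat i / 2 ^ k"
  by (simp add: dyadic_def rat_of_code_even flip: of_nat_Suc)

lemma real_of_code_lo: "real_of_code (lo c) = real (fst (prod_decode c)) / 2 ^ snd (prod_decode c)"
  by (simp add: lo_def rat_of_code_dyadic of_rat_divide of_rat_power)

lemma real_of_code_hi:
  "real_of_code (hi c) = real_of_code (lo c) + 1 / 2 ^ snd (prod_decode c)"
  unfolding real_of_code_lo
  by (simp add: hi_def rat_of_code_dyadic of_rat_divide of_rat_power of_rat_add add_divide_distrib)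

lemma lo_less_hi: "real_of_code (lo c) < real_of_code (hi c)"
  by (simp add: real_of_code_hi)

definition subcell :: "nat \<Rightarrow> nat \<Rightarrow> bool" where
  "subcell c s \<longleftrightarrow> \<not> rat_of_code (lo c) < rat_of_code (lo s) \<and> \<not> rat_of_code (hi s) < rat_of_code (hi c)"

lemma subcell_iff:
  "subcell c s \<longleftrightarrow> real_of_code (lo s) \<le> real_of_code (lo c) \<and> real_of_code (hi c) \<le> real_of_code (hi s)"
  by (simp add: subcell_def not_less of_rat_less_eq)

lemma subcell_trans: "subcell c s \<Longrightarrow> subcell s t \<Longrightarrow> subcell c t"
  by (auto simp: subcell_iff)

definition admissible :: "(nat \<Rightarrow> nat \<Rightarrow> bool) \<Rightarrow> nat \<Rightarrow> nat \<Rightarrow> nat \<Rightarrow> bool" where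
  "admissible Q n s c \<longleftrightarrow> subcell c s \<and> n < snd (prod_decode c) \<and> Q n c"

text \<open>\<open>left_half\<close> is only a default that keeps \<open>nest\<close> shrinking, and hence \<open>nest_point\<close> a real with a
  computable name, for inputs without admissible subintervals.\<close>

definition left_half :: "nat \<Rightarrow> nat" where
  "left_half s = prod_encode (2 * fst (prod_decode s), Suc (snd (prod_decode s)))"

text \<open>Code 0 is the unit interval. The result depends on \<open>Q\<close> alone, so
  presentations that yield equivalent conditions lead to the same point.\<close>

primrec nest :: "(nat \<Rightarrow> nat \<Rightarrow> bool) \<Rightarrow> nat \<Rightarrow> nat" where
  "nest Q 0 = 0"
| "nest Q (Suc n) =
    (if \<exists>c. admissible Q n (nest Q n) c then LEAST c. admissible Q n (nest Q n) c
     else left_half (nest Q n))"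

definition nest_point :: "(nat \<Rightarrow> nat \<Rightarrow> bool) \<Rightarrow> real" where
  "nest_point Q = lim (\<lambda>n. real_of_code (lo (nest Q n)))"

lemma subcell_left_half: "subcell (left_half s) s"
  unfolding subcell_iff real_of_code_hi real_of_code_lo by (simp add: left_half_def field_simps)

lemma nest_Suc: "subcell (nest Q (Suc n)) (nest Q n)"
  by (auto simp: subcell_left_half admissible_def intro: LeastI2_ex)

lemma nest_depth: "n \<le> snd (prod_decode (nest Q n))"
proof (induction n)
  case (Suc n)
  show ?case
  proof (cases "\<exists>c. admissible Q n (nest Q n) c")
    case True
    then have "admissible Q n (nest Q n) (nest Q (Suc n))"
      by (auto intro: LeastI_ex)
    then show ?thesis by (simp add: admissible_def)
  next
    case False
    then show ?thesis using Suc by (simp add: left_half_def)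
  qed
qed simp

lemma nest_subcell: "subcell (nest Q (n + i)) (nest Q n)"
proof (induction i)
  case (Suc i)
  then show ?case using subcell_trans nest_Suc[of Q "n + i"] by simp
qed (simp add: subcell_iff)

lemma unit_cell: "real_of_code (lo 0) = 0" "real_of_code (hi 0) = 1"
proof -
  have "prod_decode 0 = (0, 0)"
    by (simp add: prod_decode_def prod_decode_aux.simps)
  then show "real_of_code (lo 0) = 0" "real_of_code (hi 0) = 1"
    by (simp_all add: real_of_code_hi real_of_code_lo)
qed

text \<open>Strictness comes from the positive width of every cell; \<open>real_name\<close> asks
  for strict bounds.\<close>

lemma nest_bounds:
  "real_of_code (lo (nest Q n)) \<le> real_of_code (lo (nest Q (n + i)))"
  "real_of_code (lo (nest Q (n + i))) < real_of_code (lo (nest Q n)) + 1 / 2 ^ n"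
  "real_of_code (lo (nest Q (n + i))) < real_of_code (hi (nest Q n))"
proof -
  have r: "subcell (nest Q (n + i)) (nest Q n)" by (rule nest_subcell)
  then show "real_of_code (lo (nest Q n)) \<le> real_of_code (lo (nest Q (n + i)))"
    by (simp add: subcell_iff)
  show *: "real_of_code (lo (nest Q (n + i))) < real_of_code (hi (nest Q n))"
    using r lo_less_hi[of "nest Q (n + i)"] by (simp add: subcell_iff)
  have "(1::real) / 2 ^ snd (prod_decode (nest Q n)) \<le> 1 / 2 ^ n"
    by (intro divide_left_mono power_increasing nest_depth) auto
  with * show "real_of_code (lo (nest Q (n + i))) < real_of_code (lo (nest Q n)) + 1 / 2 ^ n"
    by (simp add: real_of_code_hi)
qed

lemma nest_point_LIMSEQ: "(\<lambda>n. real_of_code (lo (nest Q n))) \<longlonglongrightarrow> nest_point Q"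
proof -
  have "incseq (\<lambda>n. real_of_code (lo (nest Q n)))"
    using nest_bounds(1)[of Q _ 1] by (intro incseq_SucI) simp
  moreover have "real_of_code (lo (nest Q n)) \<le> 1" for n
    using nest_bounds(3)[of Q 0 n] by (simp add: unit_cell)
  ultimately have "convergent (\<lambda>n. real_of_code (lo (nest Q n)))"
    using incseq_convergent by (metis convergent_def)
  then show ?thesis by (simp add: convergent_LIMSEQ_iff nest_point_def)
qed

lemma nest_point_mem:
  "nest_point Q \<in> {real_of_code (lo (nest Q n)) .. real_of_code (hi (nest Q n))}"
proof -
  have *: "(\<lambda>i. real_of_code (lo (nest Q (i + n)))) \<longlonglongrightarrow> nest_point Q"
    using nest_point_LIMSEQ by (rule LIMSEQ_ignore_initial_segment)
  have "real_of_code (lo (nest Q n)) \<le> nest_point Q"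
    using nest_bounds(1)[of Q n] by (intro LIMSEQ_le_const[OF *]) (simp add: add.commute)
  moreover have "nest_point Q \<le> real_of_code (hi (nest Q n))"
    using nest_bounds(3)[of Q n]
    by (intro LIMSEQ_le_const2[OF *]) (auto simp: add.commute intro: less_imp_le)
  ultimately show ?thesis by simp
qed

lemma nest_point_unit: "nest_point Q \<in> {0..1}"
  using nest_point_mem[of Q 0] by (simp add: unit_cell)

lemma real_name_nest_point: "real_name (\<lambda>n. lo (nest Q n)) (nest_point Q)"
  unfolding real_name_def
proof (intro conjI allI nest_point_LIMSEQ)
  fix n i
  have "\<bar>real_of_code (lo (nest Q n)) - real_of_code (lo (nest Q (n + i)))\<bar> < real_of_rat (1 / 2 ^ n)"
    using nest_bounds[of Q n i] by (simp add: of_rat_divide of_rat_power)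
  then show "\<bar>rat_of_code (lo (nest Q n)) - rat_of_code (lo (nest Q (n + i)))\<bar> < 1 / 2 ^ n"
    by (metis abs_of_rat of_rat_diff of_rat_less)
qed

text \<open>A Baire category argument: if condition \<open>n\<close> can be met inside every cell,
  it is met by the cell chosen at stage \<open>n\<close>, and the limit lies in that closed
  cell.\<close>

lemma nest_point_generic:
  assumes "\<And>s. subcell s 0 \<Longrightarrow> \<exists>c. admissible Q n s c"
  shows "\<exists>c. subcell c 0 \<and> Q n c \<and> nest_point Q \<in> {real_of_code (lo c) .. real_of_code (hi c)}"
proof -
  have "\<exists>c. admissible Q n (nest Q n) c"
    using nest_subcell[of Q 0 n] by (intro assms) simp
  then have "admissible Q n (nest Q n) (nest Q (Suc n))"
    by (auto intro: LeastI_ex)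
  then have "Q n (nest Q (Suc n))" unfolding admissible_def by blast
  moreover have "subcell (nest Q (Suc n)) 0"
    using nest_subcell[of Q 0 "Suc n"] by (simp only: nest.simps(1) add_0)
  ultimately show ?thesis using nest_point_mem by blast
qed

lemma dyadic_neighbourhood:
  assumes "real_of_code (lo s) < x" "x < real_of_code (hi s)" "\<delta> > 0"
  obtains c where "subcell c s" "n < snd (prod_decode c)"
    "{real_of_code (lo c) .. real_of_code (hi c)} \<subseteq> {x - \<delta> <..< x + \<delta>}"
proof -
  \<comment> \<open>A cell containing \<open>x\<close> of width below this stays inside
    \<open>s\<close> as well as inside the \<open>\<delta>\<close>-neighbourhood.\<close>
  define \<epsilon> where "\<epsilon> = min \<delta> (min (x - real_of_code (lo s)) (real_of_code (hi s) - x))"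
  have "\<epsilon> > 0" using assms by (simp add: \<epsilon>_def)
  then obtain K where K: "(1 / 2) ^ K < \<epsilon>"
    using real_arch_pow_inv[of \<epsilon> "1/2"] by auto
  define k where "k = max K (Suc n)"
  have "(1 / 2 :: real) ^ k \<le> (1 / 2) ^ K" by (intro power_decreasing) (auto simp: k_def)
  then have k: "1 / 2 ^ k < \<epsilon>" using K by (simp add: power_one_over)
  have "0 \<le> real_of_code (lo s)" by (simp add: real_of_code_lo)
  then have "x > 0" using assms by linarith
  define i where "i = nat \<lfloor>x * 2 ^ k\<rfloor>"
  have i: "real i \<le> x * 2 ^ k" "x * 2 ^ k < real i + 1"
    using \<open>x > 0\<close> by (simp_all add: i_def)
  define c where "c = prod_encode (i, k)"
  have lo: "real_of_code (lo c) \<le> x" and hi: "x < real_of_code (hi c)"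
    and w: "real_of_code (hi c) = real_of_code (lo c) + 1 / 2 ^ k"
    using i by (simp_all add: c_def real_of_code_hi real_of_code_lo field_simps)
  show thesis
  proof (rule that[of c])
    show "subcell c s" using lo hi w k by (auto simp: subcell_iff \<epsilon>_def)
    show "n < snd (prod_decode c)" by (simp add: c_def k_def)
    show "{real_of_code (lo c) .. real_of_code (hi c)} \<subseteq> {x - \<delta> <..< x + \<delta>}"
      using lo hi w k by (auto simp: \<epsilon>_def)
  qed
qed

lemma subcell_unit: "subcell c 0 \<Longrightarrow> real_of_code (lo c) \<in> {0..1} \<and> real_of_code (hi c) \<in> {0..1}"
  using lo_less_hi[of c] unfolding subcell_iff unit_cell atLeastAtMost_iff by linarith

section \<open>Points outside \<open>A\<close> from suprema and from open covers\<close>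

definition sup_point :: "(real \<times> real \<Rightarrow> real) \<Rightarrow> real" where
  "sup_point \<psi> = nest_point (\<lambda>n c. \<psi> (real_of_code (lo c), real_of_code (hi c)) \<le> 1 / real (Suc n))"

lemma sup_point_spikes:
  assumes inj: "inj_on Y A"
    and sup: "\<And>p q. p \<in> {0..1} \<Longrightarrow> q \<in> {0..1} \<Longrightarrow> p \<le> q \<Longrightarrow> \<psi> (p, q) = (SUP x\<in>{p..q}. spikes A Y x)"
  shows "sup_point \<psi> \<in> {0..1} - A"
proof -
  let ?f = "spikes A Y" and ?I = "\<lambda>c. {real_of_code (lo c) .. real_of_code (hi c)}"
  let ?Q = "\<lambda>n c. \<psi> (real_of_code (lo c), real_of_code (hi c)) \<le> 1 / real (Suc n)"
  have \<psi>: "\<psi> (real_of_code (lo c), real_of_code (hi c)) = (SUP x\<in>?I c. ?f x)" if "subcell c 0" for c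
    using subcell_unit[OF that] lo_less_hi[of c] by (intro sup) auto
  have dense: "\<exists>c. admissible ?Q n s c" if "subcell s 0" for n s
  proof -
    define a b where "a = real_of_code (lo s)" and "b = real_of_code (hi s)"
    have "a < b" using lo_less_hi by (simp add: a_def b_def)
    obtain \<delta> where \<delta>: "\<delta> > 0" "\<And>z. z \<noteq> a \<Longrightarrow> dist z a < \<delta> \<Longrightarrow> ?f z < 1 / real (Suc n)"
      using spikes_small_near[OF inj, of "1 / real (Suc n)" a] by auto
    \<comment> \<open>The open interval of radius \<open>d\<close> about \<open>a + d\<close> lies
      in the cell and in the \<open>\<delta>\<close>-neighbourhood of \<open>a\<close>, but misses
      \<open>a\<close>, where the value may be large.\<close>
    define d where "d = min \<delta> (b - a) / 2"
    have d: "d > 0" "2 * d \<le> \<delta>" "2 * d \<le> b - a" using \<delta>(1) \<open>a < b\<close> by (auto simp: d_def)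
    obtain c where c: "subcell c s" "n < snd (prod_decode c)" "?I c \<subseteq> {a + d - d <..< a + d + d}"
      using dyadic_neighbourhood[of s "a + d" d n] d \<open>a < b\<close> unfolding a_def b_def by auto
    have "?f z \<le> 1 / real (Suc n)" if "z \<in> ?I c" for z
      using c(3) that \<delta>(2)[of z] d by (force simp: dist_real_def intro: less_imp_le)
    then have "(SUP x\<in>?I c. ?f x) \<le> 1 / real (Suc n)"
      using lo_less_hi[of c] by (intro cSUP_least) auto
    then have "?Q n c" using \<psi> subcell_trans[OF c(1) that] by simp
    with c show ?thesis by (auto simp: admissible_def)
  qed
  define x where "x = sup_point \<psi>"
  have small: "?f x \<le> 1 / real (Suc n)" for n
  proof -
    obtain c where c: "subcell c 0" "?Q n c" "x \<in> ?I c"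
      using nest_point_generic[of ?Q, OF dense, of n] unfolding x_def sup_point_def by auto
    have "?f x \<le> (SUP x\<in>?I c. ?f x)"
      using c(3) spikes_range by (intro cSUP_upper bdd_aboveI[of _ 1]) auto
    with c \<psi> show ?thesis by simp
  qed
  have "?f x = 0"
  proof (rule ccontr)
    assume "?f x \<noteq> 0"
    then have "?f x > 0" using spikes_range(1)[of A Y x] by simp
    then show False using small by (meson nat_approx_posE not_less)
  qed
  then show ?thesis
    using nest_point_unit unfolding x_def sup_point_def by (simp add: spikes_eq_0_iff)
qed

definition gdelta_point :: "(nat \<times> nat \<Rightarrow> rat \<times> rat) \<Rightarrow> real" where
  "gdelta_point z = nest_point (\<lambda>n c. \<exists>m.
    fst (z (m, n)) < rat_of_code (lo c) \<and> rat_of_code (hi c) < snd (z (m, n)))"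

lemma gdelta_point_spikes:
  assumes inj: "inj_on Y A"
    and z: "cont_points (spikes A Y) =
      (\<Inter>n. \<Union>m. {real_of_rat (fst (z (m, n))) <..< real_of_rat (snd (z (m, n)))})"
  shows "gdelta_point z \<in> {0..1} - A"
proof -
  let ?I = "\<lambda>c. {real_of_code (lo c) .. real_of_code (hi c)}"
  let ?Q = "\<lambda>n c. \<exists>m. fst (z (m, n)) < rat_of_code (lo c) \<and> rat_of_code (hi c) < snd (z (m, n))"
  have "countable A" using inj by (auto simp: countable_def)
  have dense: "\<exists>c. admissible ?Q n s c" if "subcell s 0" for n s
  proof -
    define a b where "a = real_of_code (lo s)" and "b = real_of_code (hi s)"
    have "a < b" using lo_less_hi by (simp add: a_def b_def)
    \<comment> \<open>\<open>A\<close> is countable, so the cell has an interior point outside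
      \<open>A\<close>. It is a continuity point and thus lies in some interval of the
      \<open>n\<close>-th open set.\<close>
    then have "uncountable {a<..<b}" by (simp add: uncountable_open_interval)
    then obtain x where x: "x \<in> {a<..<b}" "x \<notin> A"
      using \<open>countable A\<close> by (meson countable_subset subsetI)
    then have "x \<in> cont_points (spikes A Y)"
      using subcell_unit[OF that, folded a_def b_def] by (auto simp: cont_points_spikes[OF inj])
    then obtain m where m: "real_of_rat (fst (z (m, n))) < x" "x < real_of_rat (snd (z (m, n)))"
      unfolding z by auto
    define \<delta> where "\<delta> = min (x - real_of_rat (fst (z (m, n)))) (real_of_rat (snd (z (m, n))) - x)"
    obtain c where c: "subcell c s" "n < snd (prod_decode c)" "?I c \<subseteq> {x - \<delta> <..< x + \<delta>}"
      using dyadic_neighbourhood[of s x \<delta> n] x m unfolding a_def b_def \<delta>_def by auto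
    moreover have "real_of_code (lo c) \<in> ?I c" "real_of_code (hi c) \<in> ?I c"
      using lo_less_hi[of c] by auto
    ultimately have "real_of_rat (fst (z (m, n))) < real_of_code (lo c)"
        "real_of_code (hi c) < real_of_rat (snd (z (m, n)))"
      unfolding \<delta>_def by force+
    with c show ?thesis by (auto simp: admissible_def of_rat_less)
  qed
  define x where "x = gdelta_point z"
  have "\<exists>m. x \<in> {real_of_rat (fst (z (m, n))) <..< real_of_rat (snd (z (m, n)))}" for n
  proof -
    obtain c where c: "?Q n c" "x \<in> ?I c"
      using nest_point_generic[of ?Q, OF dense, of n] unfolding x_def gdelta_point_def by auto
    then obtain m where "real_of_rat (fst (z (m, n))) < real_of_code (lo c)"
        "real_of_code (hi c) < real_of_rat (snd (z (m, n)))"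
      by (auto simp: of_rat_less)
    with c(2) show ?thesis by (intro exI[of _ m]) auto
  qed
  then have "x \<in> cont_points (spikes A Y)" unfolding z by blast
  then show ?thesis by (simp add: cont_points_spikes[OF inj] x_def)
qed

section \<open>Programs relative to \<open>\<exists>\<^sup>2\<close>\<close>

text \<open>Every scheme addresses positions within the given list, and S9 passes on a prefix of
  fixed length, so trailing arguments do no harm.\<close>

lemma kleene_append: "kleene e as y \<Longrightarrow> kleene e (as @ bs) y"
proof -
  assume "kleene e as y"
  then have "kleene e (as @ bs) z" if "z = y" for z
    using that
  proof (induction arbitrary: z)
    case (S6 i as d y)
    then have "kleene d ((as @ bs) ! i # take i (as @ bs) @ drop (Suc i) (as @ bs)) z"
      by (simp add: nth_append)
    then show ?case using S6.hyps by (intro kleene.S6) auto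
  next
    case (S8_2 d F as h)
    then show ?case using kleene.S8_2[of d F "as @ bs" h] by simp
  next
    case (S8_3 d G as h)
    then show ?case using kleene.S8_3[of d G "as @ bs" h] by simp
  next
    case (S9 m as x y)
    then show ?case using kleene.S9[of m "as @ bs" x z] by simp
  qed (use kleene.S1 kleene.S2 kleene.S3 kleene.S4 kleene.S5_0 kleene.S5_Suc kleene.S7 in
      \<open>force simp del: One_nat_def\<close>)+
  then show ?thesis by blast
qed

text \<open>S6 brings one argument to the front, so the entries of \<open>xs\<close> are fetched
  from \<open>zs\<close> one by one, last first. Entries depend on \<open>v\<close> to make one
  index work for all arguments.\<close>

lemma kleene_perm:
  fixes xs ys zs :: "('v \<Rightarrow> obj) list"
  assumes "mset zs = mset xs"
  shows "\<exists>e'. \<forall>v y. kleene e (map (\<lambda>l. l v) (xs @ ys)) y \<longrightarrow> kleene e' (map (\<lambda>l. l v) (ys @ zs)) y"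
  using assms
proof (induction xs arbitrary: ys zs rule: rev_induct)
  case Nil
  then show ?case by auto
next
  case (snoc x xs)
  then have "x \<in> set zs" by (metis in_set_conv_decomp set_mset_mset)
  then obtain z1 z2 where zs: "zs = z1 @ x # z2" by (meson split_list)
  then have "mset (z1 @ z2) = mset xs" using snoc.prems by simp
  from snoc.IH[OF this, of "x # ys"] obtain e' where
    e': "\<And>v y. kleene e (map (\<lambda>l. l v) (xs @ x # ys)) y \<Longrightarrow> kleene e' (map (\<lambda>l. l v) (x # ys @ z1 @ z2)) y"
    by auto
  have "kleene (list_encode [6, e', length (ys @ z1)]) (map (\<lambda>l. l v) (ys @ zs)) y"
    if "kleene e (map (\<lambda>l. l v) ((xs @ [x]) @ ys)) y" for v y
    using e'[of v y] that by (intro kleene.S6) (auto simp: zs nth_append)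
  then show ?case by blast
qed

lemma kleene_permE:
  fixes xs zs :: "('v \<Rightarrow> obj) list"
  assumes "mset zs = mset xs"
  obtains e' where "\<And>v y. kleene e (map (\<lambda>l. l v) xs) y \<Longrightarrow> kleene e' (map (\<lambda>l. l v) zs) y"
  using kleene_perm[OF assms, of e "[]"] unfolding append_Nil append_Nil2 by blast

text \<open>An argument list depending on parameters \<open>v\<close> is given by the list \<open>Ls\<close> of its components as
  functions of \<open>v\<close>; a trailing \<open>\<exists>\<^sup>2\<close> is implicit.\<close>

definition ecomp :: "('v \<Rightarrow> obj) list \<Rightarrow> ('v \<Rightarrow> nat) \<Rightarrow> bool" where
  "ecomp Ls \<phi> \<longleftrightarrow> (\<exists>e. \<forall>v. kleene e (map (\<lambda>l. l v) (Ls @ [\<lambda>v. O2 E2])) (\<phi> v))"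

lemma ecompE:
  assumes "ecomp Ls \<phi>"
  obtains e where "\<And>v. kleene e (map (\<lambda>l. l v) (Ls @ [\<lambda>v. O2 E2])) (\<phi> v)"
  using assms unfolding ecomp_def by blast

lemma ecomp_cong: "ecomp Ls \<phi> \<Longrightarrow> (\<And>v. \<phi> v = \<psi> v) \<Longrightarrow> ecomp Ls \<psi>"
  by (metis ext)

text \<open>Substitution, weakening and exchange in one rule: extra arguments are appended, then
  everything is permuted into place.\<close>

lemma ecomp_reindex:
  assumes "ecomp Ls \<phi>" "mset (map (\<lambda>l w. l (r w)) Ls) \<subseteq># mset Ms"
  shows "ecomp Ms (\<lambda>w. \<phi> (r w))"
proof -
  let ?L = "map (\<lambda>l w. l (r w)) Ls" and ?E = "\<lambda>w. O2 E2"
  obtain e where e: "\<And>v. kleene e (map (\<lambda>l. l v) (Ls @ [\<lambda>v. O2 E2])) (\<phi> v)"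
    using assms(1) by (rule ecompE) blast
  obtain Rs where Rs: "mset Ms = mset ?L + mset Rs"
    using assms(2) by (metis ex_mset subset_mset.le_iff_add)
  have "kleene e (map (\<lambda>l. l w) ((?L @ [?E]) @ Rs)) (\<phi> (r w))" for w
    using kleene_append[OF e[of "r w"], of "map (\<lambda>l. l w) Rs"] by (simp add: comp_def)
  moreover have "mset (Ms @ [?E]) = mset ((?L @ [?E]) @ Rs)" using Rs by simp
  then obtain e' where "\<And>w y. kleene e (map (\<lambda>l. l w) ((?L @ [?E]) @ Rs)) y \<Longrightarrow>
      kleene e' (map (\<lambda>l. l w) (Ms @ [?E])) y"
    by (rule kleene_permE) blast
  ultimately show ?thesis unfolding ecomp_def by blast
qed

lemma ecomp_weaken: "ecomp Ls \<phi> \<Longrightarrow> mset Ls \<subseteq># mset Ms \<Longrightarrow> ecomp Ms \<phi>"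
  using ecomp_reindex[of Ls \<phi> "\<lambda>w. w" Ms] by simp

lemma ecomp_const: "ecomp Ls (\<lambda>v. q)"
  unfolding ecomp_def by (intro exI allI) (rule kleene.S2)

lemma ecomp_var_hd: "ecomp ((\<lambda>v. O0 (\<phi> v)) # Ls) \<phi>"
  unfolding ecomp_def append_Cons list.map by (intro exI allI) (rule kleene.S3)

lemma ecomp_var: "(\<lambda>v. O0 (\<phi> v)) \<in> set Ls \<Longrightarrow> ecomp Ls \<phi>"
  by (rule ecomp_weaken[OF ecomp_var_hd[of \<phi> "[]"]]) (simp add: in_multiset_in_set)

lemma ecomp_cut:
  assumes "ecomp Ls \<phi>" "ecomp ((\<lambda>v. O0 (\<phi> v)) # Ls) \<psi>"
  shows "ecomp Ls \<psi>"
proof -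
  obtain b where "\<And>v. kleene b (map (\<lambda>l. l v) (Ls @ [\<lambda>v. O2 E2])) (\<phi> v)"
    using assms(1) by (rule ecompE) blast
  moreover obtain d where
    "\<And>v. kleene d (map (\<lambda>l. l v) (((\<lambda>v. O0 (\<phi> v)) # Ls) @ [\<lambda>v. O2 E2])) (\<psi> v)"
    using assms(2) by (rule ecompE) blast
  ultimately have "kleene (list_encode [4, d, b]) (map (\<lambda>l. l v) (Ls @ [\<lambda>v. O2 E2])) (\<psi> v)" for v
    by (intro kleene.S4) auto
  then show ?thesis unfolding ecomp_def by blast
qed

lemma ecomp_Suc: "ecomp Ls \<phi> \<Longrightarrow> ecomp Ls (\<lambda>v. Suc (\<phi> v))"
proof (erule ecomp_cut)
  show "ecomp ((\<lambda>v. O0 (\<phi> v)) # Ls) (\<lambda>v. Suc (\<phi> v))"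
    unfolding ecomp_def append_Cons list.map by (intro exI allI) (rule kleene.S1)
qed

lemma ecomp_app1:
  assumes "(\<lambda>v. O1 (f v)) \<in> set Ls" "ecomp Ls \<phi>"
  shows "ecomp Ls (\<lambda>v. f v (\<phi> v))"
proof (rule ecomp_cut[OF assms(2)])
  have "ecomp [\<lambda>v. O1 (f v), \<lambda>v. O0 (\<phi> v)] (\<lambda>v. f v (\<phi> v))"
    unfolding ecomp_def append_Cons list.map
    by (intro exI[of _ "list_encode [7]"] allI) (rule kleene.S7)
  then show "ecomp ((\<lambda>v. O0 (\<phi> v)) # Ls) (\<lambda>v. f v (\<phi> v))"
    by (rule ecomp_weaken) (use assms(1) in \<open>simp add: in_multiset_in_set\<close>)
qed

text \<open>A fresh number variable, bound in front of the context as in de Bruijn notation.\<close>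

definition push :: "('v \<Rightarrow> obj) list \<Rightarrow> ('v \<times> nat \<Rightarrow> obj) list" where
  "push Ls = (\<lambda>w. O0 (snd w)) # map (\<lambda>l w. l (fst w)) Ls"

lemma ecomp_lift: "ecomp Ls \<phi> \<Longrightarrow> ecomp (push Ls) (\<lambda>w. \<phi> (fst w))"
  by (rule ecomp_reindex) (auto simp: push_def)

text \<open>Scheme S5. In the doubly extended context, \<open>snd w\<close> is the recursion counter
  and \<open>snd (fst w)\<close> the previous value.\<close>

lemma ecomp_rec:
  assumes "ecomp Ls \<tau>" "ecomp Ls \<beta>"
    and "ecomp (push (push Ls)) (\<lambda>w. \<sigma> (fst (fst w)) (snd w) (snd (fst w)))"
  shows "ecomp Ls (\<lambda>v. rec_nat (\<beta> v) (\<sigma> v) (\<tau> v))"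
proof (rule ecomp_cut[OF assms(1)])
  let ?as = "\<lambda>v. map (\<lambda>l. l v) (Ls @ [\<lambda>v. O2 E2])"
  obtain b where b: "\<And>v. kleene b (?as v) (\<beta> v)"
    using assms(2) by (rule ecompE) blast
  obtain d where d: "\<And>w. kleene d (map (\<lambda>l. l w) (push (push Ls) @ [\<lambda>v. O2 E2])) (\<sigma> (fst (fst w)) (snd w) (snd (fst w)))"
    using assms(3) by (rule ecompE) blast
  have d': "kleene d (O0 x # O0 z # ?as v) (\<sigma> v x z)" for v x z
    using d[of "((v, z), x)"] by (simp add: push_def comp_def)
  have "kleene (list_encode [5, b, d]) (O0 x # ?as v) (rec_nat (\<beta> v) (\<sigma> v) x)" for v x
  proof (induction x)
    case 0
    then show ?case using kleene.S5_0[OF b] by simp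
  next
    case (Suc x)
    then show ?case using kleene.S5_Suc[OF _ d'] by simp
  qed
  then show "ecomp ((\<lambda>v. O0 (\<tau> v)) # Ls) (\<lambda>v. rec_nat (\<beta> v) (\<sigma> v) (\<tau> v))"
    unfolding ecomp_def by (intro exI[of _ "list_encode [5, b, d]"]) simp
qed

lemma ecomp_app2_aux:
  assumes "ecomp (push ((\<lambda>v. O2 (F v)) # Ls)) (\<lambda>w. \<psi> (fst w) (snd w))"
  shows "ecomp ((\<lambda>v. O2 (F v)) # Ls) (\<lambda>v. F v (\<psi> v))"
proof -
  let ?as = "\<lambda>v. map (\<lambda>l. l v) (Ls @ [\<lambda>v. O2 E2])"
  obtain d where d: "\<And>w. kleene d (map (\<lambda>l. l w) (push ((\<lambda>v. O2 (F v)) # Ls) @ [\<lambda>v. O2 E2])) (\<psi> (fst w) (snd w))"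
    using assms by (rule ecompE) blast
  have "kleene d (O0 x # O2 (F v) # ?as v) (\<psi> v x)" for v x
    using d[of "(v, x)"] by (simp add: push_def comp_def)
  from kleene.S8_2[OF this] show ?thesis
    unfolding ecomp_def by (intro exI[of _ "list_encode [8, d]"]) simp
qed

lemma ecomp_app2:
  assumes "(\<lambda>v. O2 (F v)) \<in> set Ls" "ecomp (push Ls) (\<lambda>w. \<psi> (fst w) (snd w))"
  shows "ecomp Ls (\<lambda>v. F v (\<psi> v))"
proof -
  obtain xs ys where Ls: "Ls = xs @ (\<lambda>v. O2 (F v)) # ys" using assms(1) by (meson split_list)
  have "ecomp (push ((\<lambda>v. O2 (F v)) # xs @ ys)) (\<lambda>w. \<psi> (fst w) (snd w))"
    by (rule ecomp_weaken[OF assms(2)]) (simp add: push_def Ls)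
  from ecomp_app2_aux[OF this] show ?thesis
    by (rule ecomp_weaken) (simp add: Ls)
qed

definition push1 :: "('v \<Rightarrow> obj) list \<Rightarrow> ('v \<times> tp1 \<Rightarrow> obj) list" where
  "push1 Ls = (\<lambda>w. O1 (snd w)) # map (\<lambda>l w. l (fst w)) Ls"

lemma ecomp_app3:
  assumes "(\<lambda>v. O3 (G v)) \<in> set Ls" "ecomp (push1 Ls) (\<lambda>w. \<psi> (fst w) (snd w))"
  shows "ecomp Ls (\<lambda>v. G v (\<psi> v))"
proof -
  obtain xs ys where Ls: "Ls = xs @ (\<lambda>v. O3 (G v)) # ys" using assms(1) by (meson split_list)
  let ?as = "\<lambda>v. map (\<lambda>l. l v) ((xs @ ys) @ [\<lambda>v. O2 E2])"
  have "ecomp (push1 ((\<lambda>v. O3 (G v)) # xs @ ys)) (\<lambda>w. \<psi> (fst w) (snd w))"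
    by (rule ecomp_weaken[OF assms(2)]) (simp add: push1_def Ls)
  then obtain d where d: "\<And>w. kleene d (map (\<lambda>l. l w) (push1 ((\<lambda>v. O3 (G v)) # xs @ ys) @ [\<lambda>v. O2 E2])) (\<psi> (fst w) (snd w))"
    by (rule ecompE) blast
  have "kleene d (O1 h # O3 (G v) # ?as v) (\<psi> v h)" for v h
    using d[of "(v, h)"] by (simp add: push1_def comp_def)
  from kleene.S8_3[OF this] have "ecomp ((\<lambda>v. O3 (G v)) # xs @ ys) (\<lambda>v. G v (\<psi> v))"
    unfolding ecomp_def by (intro exI[of _ "list_encode [8, d]"]) simp
  then show ?thesis by (rule ecomp_weaken) (simp add: Ls)
qed

text \<open>S8 wants its functional in front, so the implicit trailing \<open>E2\<close> is moved
  there and back.\<close>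

lemma ecomp_E2:
  assumes "ecomp (push Ls) (\<lambda>w. \<psi> (fst w) (snd w))"
  shows "ecomp Ls (\<lambda>v. E2 (\<psi> v))"
proof -
  let ?E = "\<lambda>v. O2 E2"
  let ?Ms = "(\<lambda>w. O0 (snd w)) # ?E # map (\<lambda>l w. l (fst w)) Ls"
  obtain d where d: "\<And>w. kleene d (map (\<lambda>l. l w) (push Ls @ [?E])) (\<psi> (fst w) (snd w))"
    using assms by (rule ecompE) blast
  have "mset ?Ms = mset (push Ls @ [?E])" by (simp add: push_def)
  then obtain d' where d': "\<And>w y. kleene d (map (\<lambda>l. l w) (push Ls @ [?E])) y \<Longrightarrow>
      kleene d' (map (\<lambda>l. l w) ?Ms) y"
    by (rule kleene_permE) blast
  have "kleene d' (O0 x # O2 E2 # map (\<lambda>l. l v) Ls) (\<psi> v x)" for v x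
    using d'[OF d[of "(v, x)"]] by (simp add: comp_def)
  from kleene.S8_2[OF this]
  have e: "kleene (list_encode [8, d']) (map (\<lambda>l. l v) (?E # Ls)) (E2 (\<psi> v))" for v by simp
  have "mset (Ls @ [?E]) = mset (?E # Ls)" by simp
  then obtain e' where "\<And>v y. kleene (list_encode [8, d']) (map (\<lambda>l. l v) (?E # Ls)) y \<Longrightarrow>
      kleene e' (map (\<lambda>l. l v) (Ls @ [?E])) y"
    by (rule kleene_permE) blast
  with e show ?thesis unfolding ecomp_def by blast
qed

text \<open>As for \<open>\<exists>\<^sup>2\<close>, the value 0 means true.\<close>

abbreviation edec :: "('v \<Rightarrow> obj) list \<Rightarrow> ('v \<Rightarrow> bool) \<Rightarrow> bool" where
  "edec Ls P \<equiv> ecomp Ls (\<lambda>v. if P v then 0 else 1)"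

text \<open>Unbounded search by self-application: \<open>D\<close> expects its own index as first argument and
  calls it through S9. The recursive call sits in the successor branch of S5, which is not
  evaluated once the search has succeeded.\<close>

lemma ecomp_least:
  assumes "edec (push Ls) (\<lambda>w. P (fst w) (snd w))" and ex: "\<And>v. \<exists>x. P v x"
  shows "ecomp Ls (\<lambda>v. LEAST x. P v x)"
proof -
  let ?as = "\<lambda>v. map (\<lambda>l. l v) (Ls @ [\<lambda>v. O2 E2])"
  have "edec (push (push Ls)) (\<lambda>w. P (fst (fst w)) (snd (fst w)))"
    using ecomp_lift[OF assms(1)] by simp
  then obtain p where "\<And>w. kleene p (map (\<lambda>l. l w) (push (push Ls) @ [\<lambda>v. O2 E2]))
      (if P (fst (fst w)) (snd (fst w)) then 0 else 1)"
    by (rule ecompE) blast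
  from this[of "((v, m), c)" for v m c]
  have p: "kleene p (O0 c # O0 m # ?as v) (if P v m then 0 else 1)" for c m v
    by (simp add: push_def comp_def)
  \<comment> \<open>The prefix kept by S9 consists of \<open>c\<close>, \<open>Suc m\<close>, the
    entries of \<open>Ls\<close> and \<open>E2\<close>; the entries behind it are cut off.\<close>
  let ?k = "length Ls + 3"
  let ?Ms = "map (\<lambda>l w. l (fst w)) Ls @ [\<lambda>w. O2 E2] :: ('a \<times> nat \<times> nat \<times> nat \<times> nat \<Rightarrow> obj) list"
  let ?c = "\<lambda>w. O0 (fst (snd w))" and ?n = "\<lambda>w. O0 (Suc (fst (snd (snd w))))" and ?m = "\<lambda>w. O0 (fst (snd (snd w)))"
    and ?t = "\<lambda>w. O0 (fst (snd (snd (snd w))))" and ?z = "\<lambda>w. O0 (snd (snd (snd (snd w))))"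
  have "mset ([?c, ?n, ?t, ?z, ?c, ?m] @ ?Ms) = mset ([?c, ?c, ?n] @ ?Ms @ [?t, ?z, ?m])" by simp
  then obtain s where s: "\<And>w y. kleene (list_encode [9, ?k])
        (map (\<lambda>l. l w) ([?c, ?c, ?n] @ ?Ms @ [?t, ?z, ?m])) y \<Longrightarrow>
      kleene s (map (\<lambda>l. l w) ([?c, ?n, ?t, ?z, ?c, ?m] @ ?Ms)) y"
    by (rule kleene_permE) blast
  have s': "kleene s (O0 c # O0 (Suc m) # O0 t # O0 z # O0 c # O0 m # ?as v) y"
    if "kleene c (O0 c # O0 (Suc m) # ?as v) y" for c m t z v y
  proof -
    define X where "X = O0 c # O0 (Suc m) # ?as v"
    have "length X = ?k" by (simp add: X_def)
    then have "take ?k (X @ [O0 t, O0 z, O0 m]) = X" "?k \<le> length (X @ [O0 t, O0 z, O0 m])"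
      by (metis append_eq_conv_conj, simp)
    then have "kleene (list_encode [9, ?k]) (O0 c # X @ [O0 t, O0 z, O0 m]) y"
      using that by (intro kleene.S9) (auto simp: X_def)
    then show ?thesis using s[of "(v, c, m, t, z)" y] by (simp add: comp_def X_def)
  qed
  \<comment> \<open>S5 puts its counter \<open>t\<close> and previous value \<open>z\<close> before
    \<open>c\<close> and \<open>m\<close>. Position 3 holds \<open>m\<close>; once
    \<open>Suc m\<close> is in front, position 3 holds \<open>c\<close>.\<close>
  define step where "step = list_encode [4, list_encode [4, s, list_encode [6, list_encode [3], 3]], list_encode [6, list_encode [1], 3]]"
  have step: "kleene step (O0 t # O0 z # O0 c # O0 m # ?as v) y"
    if "kleene c (O0 c # O0 (Suc m) # ?as v) y" for c m t z v y
    unfolding step_def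
  proof (rule kleene.S4)
    show "kleene (list_encode [6, list_encode [1], 3]) (O0 t # O0 z # O0 c # O0 m # ?as v) (Suc m)"
      by (rule kleene.S6) (simp_all add: kleene.S1[simplified])
    show "kleene (list_encode [4, s, list_encode [6, list_encode [3], 3]])
        (O0 (Suc m) # O0 t # O0 z # O0 c # O0 m # ?as v) y"
    proof (rule kleene.S4)
      show "kleene (list_encode [6, list_encode [3], 3])
          (O0 (Suc m) # O0 t # O0 z # O0 c # O0 m # ?as v) c"
        by (rule kleene.S6) (simp_all add: kleene.S3)
    qed (rule s'[OF that])
  qed
  \<comment> \<open>The truth value from \<open>p\<close> is the recursion argument of S5: 0 returns
    \<open>m\<close>, 1 runs \<open>step\<close>.\<close>
  define D where "D = list_encode [4, list_encode [5, list_encode [6, list_encode [3], 1], step], p]"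
  have base: "kleene (list_encode [6, list_encode [3], 1]) (O0 c # O0 m # ?as v) m" for c m v
    by (rule kleene.S6) (simp_all add: kleene.S3)
  have stop: "kleene D (O0 c # O0 m # ?as v) m" if "P v m" for c m v
  proof -
    have "kleene p (O0 c # O0 m # ?as v) 0" using p[of c m v] that by simp
    then show ?thesis unfolding D_def by (rule kleene.S4) (rule kleene.S5_0[OF base])
  qed
  have continue: "kleene D (O0 c # O0 m # ?as v) y"
    if "\<not> P v m" "kleene c (O0 c # O0 (Suc m) # ?as v) y" for c m v y
  proof -
    have "kleene p (O0 c # O0 m # ?as v) (Suc 0)" using p[of c m v] that by simp
    then show ?thesis unfolding D_def
      by (rule kleene.S4) (rule kleene.S5_Suc[OF kleene.S5_0[OF base] step[OF that(2)]])
  qed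
  \<comment> \<open>Downward induction from the least witness, where the search stops without a
    recursive call.\<close>
  have D: "kleene D (O0 D # O0 m # ?as v) (LEAST x. P v x)" if "m \<le> (LEAST x. P v x)" for m v
    using that
  proof (induction m rule: inc_induct)
    case base
    have "P v (LEAST x. P v x)" using ex by (rule LeastI_ex)
    then show ?case by (rule stop)
  next
    case (step n)
    have "\<not> P v n" using step.hyps(2) by (rule not_less_Least)
    then show ?case using step.IH by (rule continue)
  qed
  have "kleene (list_encode [4, list_encode [4, D, list_encode [2, D]], list_encode [2, 0]]) (?as v) (LEAST x. P v x)" for v
    by (rule kleene.S4[OF kleene.S2 kleene.S4[OF kleene.S2 D[OF le0]]])
  then show ?thesis unfolding ecomp_def by blast
qed

section \<open>Arithmetic and logic\<close>

text \<open>The truth value serves as the number of recursion steps: zero steps give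
  \<open>\<phi>\<close>, one step gives \<open>\<psi>\<close>.\<close>

lemma ecomp_if:
  assumes "edec Ls P" "ecomp Ls \<phi>" "ecomp Ls \<psi>"
  shows "ecomp Ls (\<lambda>v. if P v then \<phi> v else \<psi> v)"
proof (rule ecomp_cong)
  show "ecomp Ls (\<lambda>v. rec_nat (\<phi> v) (\<lambda>x z. \<psi> v) (if P v then 0 else 1))"
    by (rule ecomp_rec[OF assms(1,2)]) (intro ecomp_lift assms(3))
qed simp

lemma ecomp_add:
  assumes "ecomp Ls \<phi>" "ecomp Ls \<psi>"
  shows "ecomp Ls (\<lambda>v. \<phi> v + \<psi> v)"
proof (rule ecomp_cong)
  show "ecomp Ls (\<lambda>v. rec_nat (\<psi> v) (\<lambda>x z. Suc z) (\<phi> v))"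
    by (rule ecomp_rec[OF assms]) (intro ecomp_Suc ecomp_var, simp add: push_def)
  have "rec_nat b (\<lambda>x z. Suc z) a = a + b" for a b :: nat
    by (induction a) simp_all
  then show "rec_nat (\<psi> v) (\<lambda>x z. Suc z) (\<phi> v) = \<phi> v + \<psi> v" for v .
qed

lemma ecomp_mult:
  assumes "ecomp Ls \<phi>" "ecomp Ls \<psi>"
  shows "ecomp Ls (\<lambda>v. \<phi> v * \<psi> v)"
proof (rule ecomp_cong)
  show "ecomp Ls (\<lambda>v. rec_nat 0 (\<lambda>x z. \<psi> v + z) (\<phi> v))"
    by (rule ecomp_rec[OF assms(1) ecomp_const], rule ecomp_add)
      (intro ecomp_lift assms(2), intro ecomp_var, simp add: push_def)
  have "rec_nat 0 (\<lambda>x z. b + z) a = a * b" for a b :: nat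
    by (induction a) simp_all
  then show "rec_nat 0 (\<lambda>x z. \<psi> v + z) (\<phi> v) = \<phi> v * \<psi> v" for v .
qed

lemma ecomp_power2:
  assumes "ecomp Ls \<phi>"
  shows "ecomp Ls (\<lambda>v. 2 ^ \<phi> v)"
proof (rule ecomp_cong)
  show "ecomp Ls (\<lambda>v. rec_nat 1 (\<lambda>x z. 2 * z) (\<phi> v))"
    by (rule ecomp_rec[OF assms ecomp_const], rule ecomp_mult[OF ecomp_const])
      (intro ecomp_var, simp add: push_def)
  have "rec_nat 1 (\<lambda>x z. 2 * z) a = 2 ^ a" for a :: nat
    by (induction a) simp_all
  then show "rec_nat 1 (\<lambda>x z. 2 * z) (\<phi> v) = 2 ^ \<phi> v" for v .
qed

lemma ecomp_pred:
  assumes "ecomp Ls \<phi>"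
  shows "ecomp Ls (\<lambda>v. \<phi> v - 1)"
proof (rule ecomp_cong)
  show "ecomp Ls (\<lambda>v. rec_nat 0 (\<lambda>x z. x) (\<phi> v))"
    by (rule ecomp_rec[OF assms ecomp_const]) (intro ecomp_var, simp add: push_def)
  have "rec_nat 0 (\<lambda>x z. x) a = a - 1" for a :: nat
    by (cases a) simp_all
  then show "rec_nat 0 (\<lambda>x z. x) (\<phi> v) = \<phi> v - 1" for v .
qed

lemma ecomp_minus:
  assumes "ecomp Ls \<phi>" "ecomp Ls \<psi>"
  shows "ecomp Ls (\<lambda>v. \<phi> v - \<psi> v)"
proof (rule ecomp_cong)
  show "ecomp Ls (\<lambda>v. rec_nat (\<phi> v) (\<lambda>x z. z - 1) (\<psi> v))"
    by (rule ecomp_rec[OF assms(2,1)]) (intro ecomp_pred ecomp_var, simp add: push_def)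
  have "rec_nat a (\<lambda>x z. z - 1) b = a - b" for a b :: nat
    by (induction b) simp_all
  then show "rec_nat (\<phi> v) (\<lambda>x z. z - 1) (\<psi> v) = \<phi> v - \<psi> v" for v .
qed

lemma edec_eq_0:
  assumes "ecomp Ls \<phi>"
  shows "edec Ls (\<lambda>v. \<phi> v = 0)"
proof (rule ecomp_cong)
  show "ecomp Ls (\<lambda>v. rec_nat 0 (\<lambda>x z. 1) (\<phi> v))"
    by (rule ecomp_rec[OF assms ecomp_const ecomp_const])
  have "rec_nat 0 (\<lambda>x z. 1) a = (if a = 0 then 0 else 1)" for a :: nat
    by (cases a) simp_all
  then show "rec_nat 0 (\<lambda>x z. 1) (\<phi> v) = (if \<phi> v = 0 then 0 else 1)" for v .
qed

lemma edec_not: "edec Ls P \<Longrightarrow> edec Ls (\<lambda>v. \<not> P v)"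
  by (rule ecomp_cong[OF ecomp_minus[OF ecomp_const[of Ls 1]]]) auto

lemma edec_conj:
  assumes "edec Ls P" "edec Ls Q"
  shows "edec Ls (\<lambda>v. P v \<and> Q v)"
  by (rule ecomp_cong[OF ecomp_if[OF assms ecomp_const[of Ls 1]]]) auto

lemma edec_disj:
  assumes "edec Ls P" "edec Ls Q"
  shows "edec Ls (\<lambda>v. P v \<or> Q v)"
  by (rule ecomp_cong[OF ecomp_if[OF assms(1) ecomp_const[of Ls 0] assms(2)]]) auto

lemma edec_less:
  assumes "ecomp Ls \<phi>" "ecomp Ls \<psi>"
  shows "edec Ls (\<lambda>v. \<phi> v < \<psi> v)"
  using edec_eq_0[OF ecomp_minus[OF ecomp_Suc[OF assms(1)] assms(2)]]
  by (simp add: Suc_le_eq)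

lemma edec_eq:
  assumes "ecomp Ls \<phi>" "ecomp Ls \<psi>"
  shows "edec Ls (\<lambda>v. \<phi> v = \<psi> v)"
  using edec_conj[OF edec_not[OF edec_less[OF assms]] edec_not[OF edec_less[OF assms(2,1)]]]
  by (simp add: not_less eq_iff conj_commute)

lemma edec_ex:
  assumes "edec (push Ls) (\<lambda>w. P (fst w) (snd w))"
  shows "edec Ls (\<lambda>v. \<exists>x. P v x)"
  by (rule ecomp_cong[OF ecomp_E2[OF assms]]) (auto simp: E2_def)

lemma edec_all:
  assumes "edec (push Ls) (\<lambda>w. P (fst w) (snd w))"
  shows "edec Ls (\<lambda>v. \<forall>x. P v x)"
  using edec_not[OF edec_ex[OF edec_not[OF assms]]] by simp

text \<open>Search over a decidable graph; inverses such as \<open>prod_decode\<close> are obtained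
  from their forward maps in this way.\<close>

lemma ecomp_graph:
  assumes "edec (push Ls) (\<lambda>w. R (fst w) (snd w))" "\<And>v x. R v x \<longleftrightarrow> x = \<phi> v"
  shows "ecomp Ls \<phi>"
  by (rule ecomp_cong[OF ecomp_least[OF assms(1)]]) (auto simp: assms(2) intro: Least_equality)

lemma ecomp_vars:
  "ecomp (push Ls) (\<lambda>w. snd w)"
  "ecomp (push (push Ls)) (\<lambda>w. snd (fst w))"
  "ecomp (push (push (push Ls))) (\<lambda>w. snd (fst (fst w)))"
  by (rule ecomp_var, simp add: push_def)+

lemma ecomp_prod_encode:
  assumes "ecomp Ls \<phi>" "ecomp Ls \<psi>"
  shows "ecomp Ls (\<lambda>v. prod_encode (\<phi> v, \<psi> v))"
proof (rule ecomp_cong)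
  show "ecomp Ls (\<lambda>v. rec_nat 0 (\<lambda>x z. z + Suc x) (\<phi> v + \<psi> v) + \<phi> v)"
    by (intro ecomp_add ecomp_rec assms ecomp_const ecomp_Suc ecomp_vars)
  have "rec_nat 0 (\<lambda>x z. z + Suc x) a = triangle a" for a
    by (induction a) simp_all
  then show "rec_nat 0 (\<lambda>x z. z + Suc x) (\<phi> v + \<psi> v) + \<phi> v = prod_encode (\<phi> v, \<psi> v)" for v
    by (simp add: prod_encode_def)
qed

lemma ecomp_fst_prod_decode:
  assumes "ecomp Ls \<phi>"
  shows "ecomp Ls (\<lambda>v. fst (prod_decode (\<phi> v)))"
proof (rule ecomp_graph)
  show "edec (push Ls) (\<lambda>w. \<exists>y. prod_encode (snd w, y) = \<phi> (fst w))"
    by (intro edec_ex edec_eq ecomp_prod_encode ecomp_lift[OF ecomp_lift[OF assms]] ecomp_vars)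
  show "(\<exists>y. prod_encode (x, y) = \<phi> v) \<longleftrightarrow> x = fst (prod_decode (\<phi> v))" for v x
    by (metis prod.collapse prod_decode_inverse prod_encode_inverse fst_conv)
qed

lemma ecomp_snd_prod_decode:
  assumes "ecomp Ls \<phi>"
  shows "ecomp Ls (\<lambda>v. snd (prod_decode (\<phi> v)))"
proof (rule ecomp_graph)
  show "edec (push Ls) (\<lambda>w. \<exists>y. prod_encode (y, snd w) = \<phi> (fst w))"
    by (intro edec_ex edec_eq ecomp_prod_encode ecomp_lift[OF ecomp_lift[OF assms]] ecomp_vars)
  show "(\<exists>y. prod_encode (y, x) = \<phi> v) \<longleftrightarrow> x = snd (prod_decode (\<phi> v))" for v x
    by (metis prod.collapse prod_decode_inverse prod_encode_inverse snd_conv)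
qed

lemma ecomp_div2:
  assumes "ecomp Ls \<phi>"
  shows "ecomp Ls (\<lambda>v. \<phi> v div 2)"
proof (rule ecomp_graph)
  show "edec (push Ls) (\<lambda>w. \<phi> (fst w) = 2 * snd w \<or> \<phi> (fst w) = Suc (2 * snd w))"
    by (intro edec_disj edec_eq ecomp_Suc ecomp_mult ecomp_const ecomp_lift[OF assms] ecomp_vars)
  have "(a = 2 * x \<or> a = Suc (2 * x)) \<longleftrightarrow> x = a div 2" for a x :: nat
    by presburger
  then show "(\<phi> v = 2 * x \<or> \<phi> v = Suc (2 * x)) \<longleftrightarrow> x = \<phi> v div 2" for v x .
qed

section \<open>Rational codes and nested intervals\<close>

text \<open>\<open>int_decode\<close> sends \<open>2 * n\<close> to \<open>n\<close> and
  \<open>2 * n + 1\<close> to \<open>- (n + 1)\<close>. Splitting integers into two natural parts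
  keeps programs within the naturals.\<close>

definition pos_part :: "nat \<Rightarrow> nat" where
  "pos_part a = (if a = 2 * (a div 2) then a div 2 else 0)"

definition neg_part :: "nat \<Rightarrow> nat" where
  "neg_part a = (if a = 2 * (a div 2) then 0 else Suc (a div 2))"

lemma int_decode_parts: "int_decode a = int (pos_part a) - int (neg_part a)"
  by (simp add: int_decode_def sum_decode_def pos_part_def neg_part_def even_iff_mod_2_eq_zero
      mult_div_mod_eq split: sum.split)

text \<open>Cross multiplication, with negative parts moved to the opposite side.\<close>

lemma rat_of_code_less_iff:
  "rat_of_code c < rat_of_code d \<longleftrightarrow>
    pos_part (fst (prod_decode c)) * Suc (snd (prod_decode d)) +
      neg_part (fst (prod_decode d)) * Suc (snd (prod_decode c)) <
    pos_part (fst (prod_decode d)) * Suc (snd (prod_decode c)) +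
      neg_part (fst (prod_decode c)) * Suc (snd (prod_decode d))"
proof -
  obtain a b a' b' where c: "prod_decode c = (a, b)" and d: "prod_decode d = (a', b')"
    by (metis surj_pair)
  have "rat_of_code c < rat_of_code d \<longleftrightarrow> int_decode a * (int b' + 1) < int_decode a' * (int b + 1)"
    by (simp add: rat_of_code_def c d)
  also have "\<dots> \<longleftrightarrow> int (pos_part a * Suc b' + neg_part a' * Suc b) <
      int (pos_part a' * Suc b + neg_part a * Suc b')"
    by (simp add: int_decode_parts algebra_simps)
  finally show ?thesis unfolding c d by (simp only: fst_conv snd_conv of_nat_less_iff)
qed

lemma ecomp_pos_part: "ecomp Ls \<phi> \<Longrightarrow> ecomp Ls (\<lambda>v. pos_part (\<phi> v))"
  unfolding pos_part_def
  by (rule ecomp_if) (intro edec_eq ecomp_mult ecomp_const ecomp_div2; assumption)+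

lemma ecomp_neg_part: "ecomp Ls \<phi> \<Longrightarrow> ecomp Ls (\<lambda>v. neg_part (\<phi> v))"
  unfolding neg_part_def
  by (rule ecomp_if) (intro edec_eq ecomp_mult ecomp_const ecomp_Suc ecomp_div2; assumption)+

lemma edec_rat_less:
  assumes "ecomp Ls \<phi>" "ecomp Ls \<psi>"
  shows "edec Ls (\<lambda>v. rat_of_code (\<phi> v) < rat_of_code (\<psi> v))"
  unfolding rat_of_code_less_iff
  by (intro edec_less ecomp_add ecomp_mult ecomp_pos_part ecomp_neg_part ecomp_Suc
      ecomp_fst_prod_decode ecomp_snd_prod_decode assms)

lemma ecomp_dyadic:
  "ecomp Ls \<phi> \<Longrightarrow> ecomp Ls \<psi> \<Longrightarrow> ecomp Ls (\<lambda>v. dyadic (\<phi> v) (\<psi> v))"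
  unfolding dyadic_def
  by (intro ecomp_prod_encode ecomp_mult ecomp_const ecomp_minus ecomp_power2)

lemma ecomp_lo: "ecomp Ls \<phi> \<Longrightarrow> ecomp Ls (\<lambda>v. lo (\<phi> v))"
  unfolding lo_def by (intro ecomp_dyadic ecomp_fst_prod_decode ecomp_snd_prod_decode)

lemma ecomp_hi: "ecomp Ls \<phi> \<Longrightarrow> ecomp Ls (\<lambda>v. hi (\<phi> v))"
  unfolding hi_def by (intro ecomp_dyadic ecomp_Suc ecomp_fst_prod_decode ecomp_snd_prod_decode)

lemma edec_subcell: "ecomp Ls \<phi> \<Longrightarrow> ecomp Ls \<psi> \<Longrightarrow> edec Ls (\<lambda>v. subcell (\<phi> v) (\<psi> v))"
  unfolding subcell_def by (intro edec_conj edec_not edec_rat_less ecomp_lo ecomp_hi)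

lemma ecomp_left_half: "ecomp Ls \<phi> \<Longrightarrow> ecomp Ls (\<lambda>v. left_half (\<phi> v))"
  unfolding left_half_def
  by (intro ecomp_prod_encode ecomp_mult ecomp_const ecomp_Suc ecomp_fst_prod_decode
      ecomp_snd_prod_decode)

text \<open>The search must have a witness for all arguments, so \<open>\<delta> v\<close> is made
  one when there is no other; \<open>E2\<close> decides which case holds.\<close>

lemma ecomp_least_default:
  assumes "edec (push Ls) (\<lambda>w. P (fst w) (snd w))" "ecomp Ls \<delta>"
  shows "ecomp Ls (\<lambda>v. if \<exists>x. P v x then LEAST x. P v x else \<delta> v)"
proof (rule ecomp_cong)
  let ?P = "\<lambda>v x. P v x \<or> \<not> (\<exists>x. P v x) \<and> x = \<delta> v"
  have "edec (push Ls) (\<lambda>w. \<exists>x. P (fst w) x)"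
    by (rule ecomp_lift[OF edec_ex[OF assms(1)]])
  then have "edec (push Ls) (\<lambda>w. ?P (fst w) (snd w))"
    by (intro edec_disj assms(1) edec_conj edec_not edec_eq ecomp_lift[OF assms(2)] ecomp_vars)
  then show "ecomp Ls (\<lambda>v. LEAST x. ?P v x)"
    by (rule ecomp_least) blast
  show "(LEAST x. ?P v x) = (if \<exists>x. P v x then LEAST x. P v x else \<delta> v)" for v
    by (cases "\<exists>x. P v x") (auto intro: Least_equality)
qed

lemma nest_eq_rec_nat:
  "nest Q n = rec_nat 0 (\<lambda>n s. if \<exists>c. admissible Q n s c then LEAST c. admissible Q n s c
    else left_half s) n"
  by (induction n) simp_all

lemma ecomp_nest:
  assumes "edec (push (push Ls)) (\<lambda>w. Q (fst (fst w)) (snd (fst w)) (snd w))" "ecomp Ls \<nu>"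
  shows "ecomp Ls (\<lambda>v. nest (Q v) (\<nu> v))"
  unfolding nest_eq_rec_nat
proof (rule ecomp_rec[OF assms(2) ecomp_const], rule ecomp_least_default)
  \<comment> \<open>Here \<open>u\<close> is \<open>(((v, s), n), c)\<close> with current cell
    \<open>s\<close>, stage \<open>n\<close> and candidate \<open>c\<close>; the reindexing forgets
    \<open>s\<close>.\<close>
  let ?r = "\<lambda>u. ((fst (fst (fst u)), snd (fst u)), snd u)"
  have "edec (push (push (push Ls))) (\<lambda>u. Q (fst (fst (?r u))) (snd (fst (?r u))) (snd (?r u)))"
    by (rule ecomp_reindex[OF assms(1)]) (simp add: push_def comp_def)
  then show "edec (push (push (push Ls)))
      (\<lambda>u. admissible (Q (fst (fst (fst u)))) (snd (fst u)) (snd (fst (fst u))) (snd u))"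
    unfolding admissible_def
    by (intro edec_conj edec_subcell edec_less ecomp_snd_prod_decode ecomp_vars) simp_all
  show "ecomp (push (push Ls)) (\<lambda>w. left_half (snd (fst w)))"
    by (intro ecomp_left_half ecomp_vars)
qed

section \<open>Queries to the type-3 oracle\<close>

fun sel :: "nat list \<Rightarrow> nat \<Rightarrow> nat" where
  "sel [] k = 0"
| "sel (c # cs) k = (if k = 0 then c else sel cs (k - 1))"

lemma ecomp_sel:
  assumes "\<forall>c\<in>set cs. ecomp Ls c" "ecomp Ls \<kappa>"
  shows "ecomp Ls (\<lambda>v. sel (map (\<lambda>c. c v) cs) (\<kappa> v))"
  using assms
proof (induction cs arbitrary: \<kappa>)
  case (Cons c cs)
  then have "ecomp Ls (\<lambda>v. sel (map (\<lambda>c. c v) cs) (\<kappa> v - 1))"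
    by (simp add: ecomp_minus ecomp_const)
  with Cons.prems show ?case by (simp add: ecomp_if edec_eq_0)
qed (simp add: ecomp_const)

text \<open>The answer of \<open>G\<close> on the coded tuple of \<open>r\<close> copies of the
  spike function followed by constant arguments \<open>cs\<close>.\<close>

definition query :: "tp3 \<Rightarrow> tp2 \<Rightarrow> tp2 \<Rightarrow> nat \<Rightarrow> nat list \<Rightarrow> nat" where
  "query G FA FY r cs =
    G (\<lambda>h. if h 0 < r then spikes_rep FA FY (tail h) else sel cs (h 0 - r))"

text \<open>The condition on \<open>as\<close> holds for numbers and for constant sequences, the
  only further arguments that are ever passed.\<close>

lemma tuple_query:
  assumes "list_all2 (\<lambda>a c. as_tp2 a = (\<lambda>h. c)) as cs"
  shows "G (tuple (replicate r (O2 (spikes_rep FA FY)) @ as)) = query G FA FY r cs"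
proof -
  have sel: "(if k < length as then as_tp2 (as ! k) h else 0) = sel cs k" for k h
    using assms
  proof (induction as cs arbitrary: k rule: list_all2_induct)
    case (Cons a as c cs)
    show ?case
    proof (cases k)
      case 0
      then show ?thesis using Cons.hyps by simp
    next
      case (Suc k')
      then show ?thesis using Cons.IH[of k'] by (simp split: if_split_asm)
    qed
  qed simp
  have "tuple (replicate r (O2 (spikes_rep FA FY)) @ as) h =
      (if h 0 < r then spikes_rep FA FY (tail h) else sel cs (h 0 - r))" for h
    using sel[of "h 0 - r" "\<lambda>i. h (Suc i)"]
    by (auto simp: tuple_def nth_append tail_def less_diff_conv2 not_less split: if_splits)
  then have "tuple (replicate r (O2 (spikes_rep FA FY)) @ as) =
      (\<lambda>h. if h 0 < r then spikes_rep FA FY (tail h) else sel cs (h 0 - r))"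
    by (rule ext)
  then show ?thesis by (simp only: query_def)
qed

lemma ecomp_query:
  assumes "(\<lambda>v. O3 (G v)) \<in> set Ls" "(\<lambda>v. O2 (FA v)) \<in> set Ls" "(\<lambda>v. O2 (FY v)) \<in> set Ls"
    and "\<forall>c\<in>set cs. ecomp Ls c"
  shows "ecomp Ls (\<lambda>v. query (G v) (FA v) (FY v) r (map (\<lambda>c. c v) cs))"
  unfolding query_def
proof (rule ecomp_app3[OF assms(1)])
  have lift: "ecomp (push1 Ls) (\<lambda>w. c (fst w))" if "ecomp Ls c" for c
    by (rule ecomp_reindex[OF that]) (simp add: push1_def)
  have h: "ecomp (push1 Ls) (\<lambda>w. snd w 0)"
    by (rule ecomp_app1[where f = "\<lambda>u. snd u", OF _ ecomp_const]) (simp add: push1_def)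
  \<comment> \<open>Two entries of the input are skipped: the position in the tuple and the
    precision. The rest names a real.\<close>
  have "ecomp (push (push1 Ls)) (\<lambda>u. snd (fst u) (Suc (Suc (snd u))))"
    by (rule ecomp_app1[where f = "\<lambda>u. snd (fst u)"])
      (simp add: push_def push1_def, intro ecomp_Suc ecomp_vars)
  then have tt: "ecomp (push1 Ls) (\<lambda>w. F (fst w) (\<lambda>i. snd w (Suc (Suc i))))"
    if "(\<lambda>v. O2 (F v)) \<in> set Ls" for F
    using that
    by (intro ecomp_app2[where F = "\<lambda>w. F (fst w)" and \<psi> = "\<lambda>w i. snd w (Suc (Suc i))"])
      (auto simp: push1_def)
  have rep: "ecomp (push1 Ls) (\<lambda>w. spikes_rep (FA (fst w)) (FY (fst w)) (tail (snd w)))"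
    unfolding spikes_rep_def tail_def
    by (rule ecomp_if) (intro edec_eq_0 ecomp_prod_encode ecomp_const tt assms(2,3))+
  have "ecomp (push1 Ls) (\<lambda>w. sel (map (\<lambda>c. c w) (map (\<lambda>c w. c (fst w)) cs)) (snd w 0 - r))"
    using assms(4) lift by (intro ecomp_sel ecomp_minus h ecomp_const) auto
  then have "ecomp (push1 Ls) (\<lambda>w. sel (map (\<lambda>c. c (fst w)) cs) (snd w 0 - r))"
    by (simp add: comp_def)
  with rep h show "ecomp (push1 Ls) (\<lambda>w. if snd w 0 < r then spikes_rep (FA (fst w)) (FY (fst w)) (tail (snd w))
      else sel (map (\<lambda>c. c (fst w)) cs) (snd w 0 - r))"
    by (intro ecomp_if[OF edec_less[OF _ ecomp_const]])
qed

section \<open>The three problems\<close>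

lemma rfun_arg_spikes_rep:
  assumes "\<And>g x. real_name g x \<Longrightarrow> FA g = indicator A x" "\<And>g x. real_name g x \<Longrightarrow> FY g = Y x"
  shows "rfun_arg [O2 (spikes_rep FA FY)] (spikes A Y)"
  unfolding rfun_arg_def using assms by (auto intro: real_name_spikes_rep)

section \<open>Comparing a named real with a rational\<close>

lemma real_name_dist_le:
  assumes "real_name g x"
  shows "\<bar>real_of_code (g n) - x\<bar> \<le> 1 / 2 ^ n"
proof -
  have "\<bar>real_of_code (g n) - real_of_code (g (n + i))\<bar> \<le> 1 / 2 ^ n" for i
  proof -
    have "\<bar>rat_of_code (g n) - rat_of_code (g (n + i))\<bar> < 1 / 2 ^ n"
      using assms by (auto simp: real_name_def)
    then have "real_of_rat \<bar>rat_of_code (g n) - rat_of_code (g (n + i))\<bar> < real_of_rat (1 / 2 ^ n)"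
      by (simp only: of_rat_less)
    then show ?thesis by (simp add: of_rat_diff of_rat_divide of_rat_power flip: abs_of_rat)
  qed
  moreover have "(\<lambda>i. real_of_code (g (i + n))) \<longlonglongrightarrow> x"
    using assms LIMSEQ_ignore_initial_segment[of "\<lambda>i. real_of_code (g i)" x n]
    by (simp add: real_name_def)
  then have "(\<lambda>i. \<bar>real_of_code (g n) - real_of_code (g (i + n))\<bar>) \<longlonglongrightarrow> \<bar>real_of_code (g n) - x\<bar>"
    by (intro tendsto_intros)
  ultimately show ?thesis
    by (intro LIMSEQ_le_const2[of "\<lambda>i. \<bar>real_of_code (g n) - real_of_code (g (i + n))\<bar>"])
      (auto simp: add.commute)
qed

definition threshold :: "nat \<Rightarrow> nat \<Rightarrow> nat" where
  "threshold n j = prod_encode (2 * (2 ^ j + Suc n), Suc n * 2 ^ j - 1)"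

lemma real_of_code_threshold: "real_of_code (threshold n j) = 1 / real (Suc n) + 1 / 2 ^ j"
proof -
  have "Suc (Suc n * 2 ^ j - 1) = Suc n * 2 ^ j" by simp
  then have "rat_of_code (threshold n j) = of_nat (2 ^ j + Suc n) / of_nat (Suc n * 2 ^ j)"
    unfolding threshold_def rat_of_code_even by simp
  then have "real_of_code (threshold n j) = real (2 ^ j + Suc n) / real (Suc n * 2 ^ j)"
    by (metis of_rat_divide of_rat_of_nat_eq)
  also have "\<dots> = 1 / real (Suc n) + 1 / 2 ^ j"
    by (simp add: field_simps)
  finally show ?thesis .
qed

text \<open>A weak inequality is a universal statement about the approximations, each allowed its
  error \<open>1 / 2 ^ j\<close>; hence \<open>E2\<close> decides it, whatever the name.\<close>

lemma real_name_le_iff: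
  assumes "real_name g x"
  shows "x \<le> 1 / real (Suc n) \<longleftrightarrow> (\<forall>j. \<not> rat_of_code (threshold n j) < rat_of_code (g j))"
proof -
  have *: "\<not> rat_of_code (threshold n j) < rat_of_code (g j) \<longleftrightarrow>
      real_of_code (g j) \<le> 1 / real (Suc n) + 1 / 2 ^ j" for j
    by (simp only: of_rat_less[symmetric, where 'a = real] real_of_code_threshold not_less)
  show ?thesis unfolding *
  proof
    assume x: "x \<le> 1 / real (Suc n)"
    show "\<forall>j. real_of_code (g j) \<le> 1 / real (Suc n) + 1 / 2 ^ j"
    proof
      fix j
      show "real_of_code (g j) \<le> 1 / real (Suc n) + 1 / 2 ^ j"
        using x real_name_dist_le[OF assms, of j] by linarith
    qed
  next
    assume le: "\<forall>j. real_of_code (g j) \<le> 1 / real (Suc n) + 1 / 2 ^ j"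
    have "(\<lambda>j. (1 / 2 :: real) ^ j) \<longlonglongrightarrow> 0"
      by (intro LIMSEQ_power_zero) simp
    then have "(\<lambda>j. 1 / real (Suc n) + 1 / 2 ^ j) \<longlonglongrightarrow> 1 / real (Suc n) + 0"
      by (intro tendsto_add tendsto_const) (simp add: power_one_over)
    moreover have "(\<lambda>j. real_of_code (g j)) \<longlonglongrightarrow> x"
      using assms by (simp add: real_name_def)
    ultimately show "x \<le> 1 / real (Suc n)"
      using le by (intro LIMSEQ_le[of "\<lambda>j. real_of_code (g j)" x]) auto
  qed
qed

section \<open>Reductions common to the three problems\<close>

text \<open>On a closed spike function the answers of program \<open>e\<close> would be decoded to a
  point of \<open>A\<close>, whereas \<open>T\<close> yields a point outside
  \<open>A\<close>.\<close>

lemma not_computable_from_closed: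
  fixes P :: "nat \<Rightarrow> sym list" and R :: "tp1 \<Rightarrow> real" and T :: "(real \<Rightarrow> real) \<Rightarrow> real"
  assumes T: "\<And>A Y. inj_on Y A \<Longrightarrow> T (spikes A Y) \<notin> A"
    and comp: "\<And>F A Y. rfun_arg [O2 F] (spikes A Y) \<Longrightarrow>
      \<exists>c. (\<forall>n. kleene e (map (interp v H F) (P n)) (c n)) \<and> R c = T (spikes A Y)"
  shows False
proof -
  obtain A Y where inj: "inj_on Y A" and closed:
    "\<And>e c. (\<And>n. kleene e (map (interp v H (spikes_rep (name_mem A) (name_value Y))) (P n)) (c n)) \<Longrightarrow>
      R c \<in> A"
    by (rule closed_spikes_exist[of v H P R]) blast
  have "rfun_arg [O2 (spikes_rep (name_mem A) (name_value Y))] (spikes A Y)"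
    by (intro rfun_arg_spikes_rep name_mem name_value)
  then obtain c where "\<And>n. kleene e (map (interp v H (spikes_rep (name_mem A) (name_value Y))) (P n)) (c n)"
    "R c = T (spikes A Y)"
    using comp by blast
  with closed T[OF inj] show False by metis
qed

definition oracles :: "(tp3 \<times> tp2 \<times> tp2 \<Rightarrow> obj) list" where
  "oracles = [\<lambda>v. O3 (fst v), \<lambda>v. O2 (fst (snd v)), \<lambda>v. O2 (snd (snd v))]"

lemma computes_cantor_realiser_if_ecomp:
  fixes T :: "(real \<Rightarrow> real) \<Rightarrow> real" and val :: "tp3 \<Rightarrow> tp2 \<Rightarrow> tp2 \<Rightarrow> nat \<Rightarrow> nat"
  assumes T: "\<And>A Y. inj_on Y A \<Longrightarrow> T (spikes A Y) \<in> {0..1} - A"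
    and val: "ecomp (push oracles) (\<lambda>w. val (fst (fst w)) (fst (snd (fst w))) (snd (snd (fst w))) (snd w))"
    and name: "\<And>G FA FY A Y. presents arg out G \<Phi> \<Longrightarrow> rfun_arg [O2 (spikes_rep FA FY)] (spikes A Y) \<Longrightarrow>
      real_name (val G FA FY) (T (spikes A Y))"
  shows "computes_cantor_realiser arg out \<Phi>"
  unfolding computes_cantor_realiser_def
proof (intro exI conjI)
  let ?\<Gamma> = "\<lambda>(A, Y). T (spikes A Y)"
  show "cantor_realiser ?\<Gamma>" using T by (simp add: cantor_realiser_def)
  obtain e where e: "\<And>w. kleene e (map (\<lambda>l. l w) (push oracles @ [\<lambda>v. O2 E2]))
      (val (fst (fst w)) (fst (snd (fst w))) (snd (snd (fst w))) (snd w))"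
    using val by (rule ecompE) blast
  \<comment> \<open>The argument order demanded by the definition of the realiser, with
    \<open>E2\<close> directly after \<open>G\<close>.\<close>
  let ?Ms = "[\<lambda>w. O3 (fst (fst w)), \<lambda>w. O2 E2, \<lambda>w. O2 (fst (snd (fst w))),
    \<lambda>w. O2 (snd (snd (fst w))), \<lambda>w. O0 (snd w)] :: ((tp3 \<times> tp2 \<times> tp2) \<times> nat \<Rightarrow> obj) list"
  have "mset ?Ms = mset (push oracles @ [\<lambda>v. O2 E2])" by (simp add: push_def oracles_def)
  then obtain e' where e': "\<And>w y. kleene e (map (\<lambda>l. l w) (push oracles @ [\<lambda>v. O2 E2])) y \<Longrightarrow>
      kleene e' (map (\<lambda>l. l w) ?Ms) y"
    by (rule kleene_permE) blast
  have val': "kleene e' [O3 G, O2 E2, O2 FA, O2 FY, O0 n] (val G FA FY n)" for G FA FY n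
    using e'[OF e[of "((G, FA, FY), n)"]] by simp
  show "computable_in {[O3 G, O2 E2] | G. presents arg out G \<Phi>} (rset_arg \<otimes>\<^sub>a rnat_arg) real_name ?\<Gamma>"
    unfolding computable_in_def
  proof (intro exI[of _ e'] ballI allI impI)
    fix os as x
    assume "os \<in> {[O3 G, O2 E2] | G. presents arg out G \<Phi>}" and x: "(rset_arg \<otimes>\<^sub>a rnat_arg) as x"
    then obtain G where G: "os = [O3 G, O2 E2]" "presents arg out G \<Phi>" by blast
    obtain A Y where AY: "x = (A, Y)" by (cases x)
    obtain FA FY where F: "as = [O2 FA, O2 FY]"
      "\<And>g x. real_name g x \<Longrightarrow> FA g = indicator A x" "\<And>g x. real_name g x \<Longrightarrow> FY g = Y x"
      using x unfolding pair_arg_def rset_arg_def rnat_arg_def AY by auto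
    have "real_name (val G FA FY) (?\<Gamma> x)"
      using name[OF G(2) rfun_arg_spikes_rep[OF F(2,3)]] by (simp add: AY)
    moreover have "kleene e' (os @ as @ [O0 n]) (val G FA FY n)" for n
      using val'[of G FA FY n] by (simp add: G F)
    ultimately show "\<exists>g. real_name g (?\<Gamma> x) \<and> (\<forall>n. kleene e' (os @ as @ [O0 n]) (g n))"
      by blast
  qed
qed

lemma query_presents:
  assumes "presents arg out G \<Phi>" "arg (replicate r (O2 (spikes_rep FA FY)) @ as) x"
    and "\<And>n. list_all2 (\<lambda>a c. as_tp2 a = (\<lambda>h. c)) (as @ [O0 n]) (cs n)"
  shows "out (\<lambda>n. query G FA FY r (cs n)) (\<Phi> x)"
proof -
  have "G (tuple ((replicate r (O2 (spikes_rep FA FY)) @ as) @ [O0 n])) = query G FA FY r (cs n)" for n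
    using tuple_query[OF assms(3)] by simp
  moreover have "out (\<lambda>n. G (tuple ((replicate r (O2 (spikes_rep FA FY)) @ as) @ [O0 n]))) (\<Phi> x)"
    using assms(1,2) unfolding presents_def by blast
  ultimately show ?thesis by (simp only:)
qed

lemma ecomp_query_oracles:
  assumes "(\<lambda>v. O3 (fst (\<pi> v))) \<in> set Ls" "(\<lambda>v. O2 (fst (snd (\<pi> v)))) \<in> set Ls"
    "(\<lambda>v. O2 (snd (snd (\<pi> v)))) \<in> set Ls" "\<forall>c\<in>set cs. ecomp Ls c"
  shows "ecomp Ls (\<lambda>v. query (fst (\<pi> v)) (fst (snd (\<pi> v))) (snd (snd (\<pi> v))) r (map (\<lambda>c. c v) cs))"
  using assms by (rule ecomp_query)

text \<open>The three problems are treated for an arbitrary input space in which \<open>X f\<close> is named by \<open>r\<close>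
  copies of a name of \<open>f\<close>. The variant with the oscillation function is the case \<open>r = 2\<close>, as
  \<open>spikes A Y\<close> is its own oscillation function.\<close>

context
  fixes arg :: "obj list \<Rightarrow> 'a \<Rightarrow> bool" and X :: "(real \<Rightarrow> real) \<Rightarrow> 'a" and r :: nat
  assumes arg: "\<And>F f. rfun_arg [O2 F] f \<Longrightarrow> arg (replicate r (O2 F)) (X f)"
begin

lemma continuity_point_functional:
  assumes \<Phi>: "\<And>A Y. inj_on Y A \<Longrightarrow> \<Phi> (X (spikes A Y)) \<in> cont_points (spikes A Y)"
  shows "\<not> computable_in_S2 k arg real_name \<Phi>" "computes_cantor_realiser arg real_name \<Phi>"
proof -
  have T: "\<Phi> (X (spikes A Y)) \<in> {0..1} - A" if "inj_on Y A" for A Y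
    using \<Phi>[OF that] cont_points_spikes[OF that] by simp
  show "\<not> computable_in_S2 k arg real_name \<Phi>"
  proof
    assume "computable_in_S2 k arg real_name \<Phi>"
    then obtain e where e: "\<And>as x. arg as x \<Longrightarrow>
        \<exists>g. real_name g (\<Phi> x) \<and> (\<forall>n. kleene e (O2 (S2_functional k) # as @ [O0 n]) (g n))"
      by (auto simp: computable_in_S2_def computable_in_def)
    \<comment> \<open>The answers at \<open>n\<close> form a name of the point, which
      \<open>R\<close> reads off.\<close>
    show False
    proof (rule not_computable_from_closed[where T = "\<lambda>f. \<Phi> (X f)" and e = e and H = "S2_functional k"
          and v = "\<lambda>j i. j" and P = "\<lambda>n. Fix # replicate r Var @ [Num n]" and R = "\<lambda>c. THE x. real_name c x"])
      fix F :: tp2 and A Y assume "rfun_arg [O2 F] (spikes A Y)"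
      from e[OF arg[OF this]] obtain g where g: "real_name g (\<Phi> (X (spikes A Y)))"
        "\<And>n. kleene e (O2 (S2_functional k) # replicate r (O2 F) @ [O0 n]) (g n)"
        by blast
      moreover have "(THE x. real_name g x) = \<Phi> (X (spikes A Y))"
        using g(1) real_name_unique by blast
      ultimately show "\<exists>c. (\<forall>n. kleene e (map (interp (\<lambda>j i. j) (S2_functional k) F)
          (Fix # replicate r Var @ [Num n])) (c n)) \<and> (THE x. real_name c x) = \<Phi> (X (spikes A Y))"
        by auto
    qed (use T in auto)
  qed
  show "computes_cantor_realiser arg real_name \<Phi>"
  proof (rule computes_cantor_realiser_if_ecomp[where T = "\<lambda>f. \<Phi> (X f)"
        and val = "\<lambda>G FA FY n. query G FA FY r [n]", OF T])
    have "ecomp (push oracles) (\<lambda>w. query (fst (fst w)) (fst (snd (fst w))) (snd (snd (fst w))) r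
        (map (\<lambda>c. c w) [\<lambda>w. snd w]))"
      by (rule ecomp_query_oracles[where \<pi> = fst])
        ((simp add: push_def oracles_def; fail)+, simp add: ecomp_vars)
    then show "ecomp (push oracles) (\<lambda>w. query (fst (fst w)) (fst (snd (fst w))) (snd (snd (fst w))) r [snd w])"
      by (simp only: list.map)
    fix G FA FY A Y
    assume G: "presents arg real_name G \<Phi>" and F: "rfun_arg [O2 (spikes_rep FA FY)] (spikes A Y)"
    have "arg (replicate r (O2 (spikes_rep FA FY)) @ []) (X (spikes A Y))"
      using arg[OF F] by simp
    from query_presents[OF G this, of "\<lambda>n. [n]"]
    show "real_name (\<lambda>n. query G FA FY r [n]) (\<Phi> (X (spikes A Y)))"
      by simp
  qed
qed

lemma supremum_functional:
  assumes \<Psi>: "\<And>A Y p q. inj_on Y A \<Longrightarrow> p \<in> {0..1} \<Longrightarrow> q \<in> {0..1} \<Longrightarrow> p \<le> q \<Longrightarrow>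
      \<Psi> (X (spikes A Y)) (p, q) = (SUP x\<in>{p..q}. spikes A Y x)"
  shows "\<not> computable_in_S2 k (arg \<otimes>\<^sub>a real_arg \<otimes>\<^sub>a real_arg) real_name (case_prod \<Psi>)"
    "computes_cantor_realiser (arg \<otimes>\<^sub>a real_arg \<otimes>\<^sub>a real_arg) real_name (case_prod \<Psi>)"
proof -
  let ?arg = "arg \<otimes>\<^sub>a real_arg \<otimes>\<^sub>a real_arg"
  have T: "sup_point (\<Psi> (X (spikes A Y))) \<in> {0..1} - A" if "inj_on Y A" for A Y
    using that \<Psi> by (intro sup_point_spikes) auto
  \<comment> \<open>End points are passed as constant names of rationals, so they can be symbols
    \<open>Fn\<close> on one side and constants of a query on the other.\<close>
  have arg': "?arg (replicate r (O2 F) @ [O1 (\<lambda>i. c), O1 (\<lambda>i. d)]) (X f, real_of_code c, real_of_code d)"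
    if "rfun_arg [O2 F] f" for F f c d
  proof -
    have "(real_arg \<otimes>\<^sub>a real_arg) ([O1 (\<lambda>i. c)] @ [O1 (\<lambda>i. d)]) (real_of_code c, real_of_code d)"
      unfolding pair_arg_def real_arg_def fst_conv snd_conv using real_name_const by blast
    then show ?thesis
      using arg[OF that] unfolding pair_arg_def[of arg] by auto
  qed
  show "\<not> computable_in_S2 k ?arg real_name (case_prod \<Psi>)"
  proof
    assume "computable_in_S2 k ?arg real_name (case_prod \<Psi>)"
    then obtain e where e: "\<And>as x. ?arg as x \<Longrightarrow>
        \<exists>g. real_name g (case_prod \<Psi> x) \<and> (\<forall>n. kleene e (O2 (S2_functional k) # as @ [O0 n]) (g n))"
      by (auto simp: computable_in_S2_def computable_in_def)
    \<comment> \<open>Query \<open>n\<close> codes a cell \<open>c\<close> and a precision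
      \<open>j\<close>; the answers for fixed \<open>c\<close> name the supremum over
      \<open>c\<close>.\<close>
    let ?P = "\<lambda>n. case prod_decode n of (c, j) \<Rightarrow> Fix # replicate r Var @ [Fn (lo c), Fn (hi c), Num j]"
    let ?R = "\<lambda>g. nest_point (\<lambda>n c. (THE x. real_name (\<lambda>j. g (prod_encode (c, j))) x) \<le> 1 / real (Suc n))"
    show False
    proof (rule not_computable_from_closed[where T = "\<lambda>f. sup_point (\<Psi> (X f))" and e = e
          and H = "S2_functional k" and v = "\<lambda>j i. j" and P = ?P and R = ?R])
      fix F :: tp2 and A Y assume F: "rfun_arg [O2 F] (spikes A Y)"
      let ?\<psi> = "\<Psi> (X (spikes A Y))"
      have "\<exists>g. real_name g (?\<psi> (real_of_code (lo c), real_of_code (hi c))) \<and>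
        (\<forall>n. kleene e (O2 (S2_functional k) # replicate r (O2 F) @ [O1 (\<lambda>i. lo c), O1 (\<lambda>i. hi c), O0 n]) (g n))" for c
        using e[OF arg'[OF F]] by simp
      then obtain g where g: "\<And>c. real_name (g c) (?\<psi> (real_of_code (lo c), real_of_code (hi c)))"
        "\<And>c n. kleene e (O2 (S2_functional k) # replicate r (O2 F) @ [O1 (\<lambda>i. lo c), O1 (\<lambda>i. hi c), O0 n]) (g c n)"
        by metis
      have the: "(THE x. real_name (g c) x) = ?\<psi> (real_of_code (lo c), real_of_code (hi c))" for c
        using g(1) real_name_unique by blast
      show "\<exists>c. (\<forall>n. kleene e (map (interp (\<lambda>j i. j) (S2_functional k) F) (?P n)) (c n)) \<and>
          ?R c = sup_point ?\<psi>"
        by (rule exI[of _ "\<lambda>n. case prod_decode n of (c, j) \<Rightarrow> g c j"])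
          (simp add: g(2) the sup_point_def split: prod.split)
    qed (use T in auto)
  qed
  \<comment> \<open>The supremum condition, phrased through approximations as in
    \<open>real_name_le_iff\<close> to be decidable.\<close>
  let ?Q = "\<lambda>G FA FY n c. \<forall>j. \<not> rat_of_code (threshold n j) < rat_of_code (query G FA FY r [lo c, hi c, j])"
  show "computes_cantor_realiser ?arg real_name (case_prod \<Psi>)"
  proof (rule computes_cantor_realiser_if_ecomp[where T = "\<lambda>f. sup_point (\<Psi> (X f))"
        and val = "\<lambda>G FA FY n. lo (nest (?Q G FA FY) n)", OF T])
    let ?L = "push (push (push (push oracles)))" and ?\<pi> = "\<lambda>u. fst (fst (fst (fst u)))"
    have "ecomp ?L (\<lambda>u. query (fst (?\<pi> u)) (fst (snd (?\<pi> u))) (snd (snd (?\<pi> u))) r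
        (map (\<lambda>c. c u) [\<lambda>u. lo (snd (fst u)), \<lambda>u. hi (snd (fst u)), \<lambda>u. snd u]))"
      by (rule ecomp_query_oracles[where \<pi> = ?\<pi>])
        ((simp add: push_def oracles_def; fail)+, simp add: ecomp_lo ecomp_hi ecomp_vars)
    then have "edec ?L (\<lambda>u. \<not> rat_of_code (threshold (snd (fst (fst u))) (snd u)) <
        rat_of_code (query (fst (?\<pi> u)) (fst (snd (?\<pi> u))) (snd (snd (?\<pi> u))) r
          [lo (snd (fst u)), hi (snd (fst u)), snd u]))"
      unfolding threshold_def
      by (intro edec_not edec_rat_less ecomp_prod_encode ecomp_mult ecomp_const ecomp_add ecomp_minus
          ecomp_power2 ecomp_Suc ecomp_vars) (simp only: list.map)
    then have "edec (push (push (push oracles))) (\<lambda>w. ?Q (fst (fst (fst (fst w))))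
        (fst (snd (fst (fst (fst w))))) (snd (snd (fst (fst (fst w))))) (snd (fst w)) (snd w))"
      by (rule edec_all)
    then show "ecomp (push oracles) (\<lambda>w. lo (nest (?Q (fst (fst w)) (fst (snd (fst w))) (snd (snd (fst w)))) (snd w)))"
      by (intro ecomp_lo ecomp_nest ecomp_vars)
    fix G FA FY A Y
    assume G: "presents ?arg real_name G (case_prod \<Psi>)" and F: "rfun_arg [O2 (spikes_rep FA FY)] (spikes A Y)"
    let ?\<psi> = "\<Psi> (X (spikes A Y))"
    have "real_name (\<lambda>j. query G FA FY r [lo c, hi c, j]) (?\<psi> (real_of_code (lo c), real_of_code (hi c)))" for c
      using query_presents[OF G arg'[OF F, of "lo c" "hi c"], of "\<lambda>j. [lo c, hi c, j]"] by simp
    from real_name_le_iff[OF this]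
    have "?Q G FA FY = (\<lambda>n c. ?\<psi> (real_of_code (lo c), real_of_code (hi c)) \<le> 1 / real (Suc n))"
      by (intro ext) blast
    then show "real_name (\<lambda>n. lo (nest (?Q G FA FY) n)) (sup_point ?\<psi>)"
      unfolding sup_point_def by (simp only: real_name_nest_point)
  qed
qed

lemma gdelta_functional:
  assumes \<zeta>: "\<And>A Y. inj_on Y A \<Longrightarrow> cont_points (spikes A Y) =
      (\<Inter>n. \<Union>m. {real_of_rat (fst (\<zeta> (X (spikes A Y)) (m, n))) <..< real_of_rat (snd (\<zeta> (X (spikes A Y)) (m, n)))})"
  shows "\<not> computable_in_S2 k (arg \<otimes>\<^sub>a nat_arg \<otimes>\<^sub>a nat_arg) rat_pair_name (case_prod \<zeta>)"
    "computes_cantor_realiser (arg \<otimes>\<^sub>a nat_arg \<otimes>\<^sub>a nat_arg) rat_pair_name (case_prod \<zeta>)"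
proof -
  let ?arg = "arg \<otimes>\<^sub>a nat_arg \<otimes>\<^sub>a nat_arg" and ?dec = "\<lambda>c. map_prod rat_of_code rat_of_code (prod_decode c)"
  have T: "gdelta_point (\<zeta> (X (spikes A Y))) \<in> {0..1} - A" if "inj_on Y A" for A Y
    using that \<zeta>[OF that] by (rule gdelta_point_spikes)
  have arg': "?arg (replicate r (O2 F) @ [O0 m, O0 n]) (X f, m, n)" if "rfun_arg [O2 F] f" for F f m n
  proof -
    have "(nat_arg \<otimes>\<^sub>a nat_arg) ([O0 m] @ [O0 n]) (m, n)"
      unfolding pair_arg_def nat_arg_def by simp
    then show ?thesis
      using arg[OF that] unfolding pair_arg_def[of arg] by auto
  qed
  show "\<not> computable_in_S2 k ?arg rat_pair_name (case_prod \<zeta>)"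
  proof
    assume "computable_in_S2 k ?arg rat_pair_name (case_prod \<zeta>)"
    then obtain e where e: "\<And>as x. ?arg as x \<Longrightarrow>
        \<exists>g. rat_pair_name g (case_prod \<zeta> x) \<and> (\<forall>n. kleene e (O2 (S2_functional k) # as @ [O0 n]) (g n))"
      by (auto simp: computable_in_S2_def computable_in_def)
    \<comment> \<open>The last argument is 0 since \<open>rat_pair_name\<close> stores the whole
      pair in the first value.\<close>
    let ?P = "\<lambda>i. case prod_decode i of (m, n) \<Rightarrow> Fix # replicate r Var @ [Num m, Num n, Num 0]"
    let ?R = "\<lambda>g. gdelta_point (\<lambda>i. ?dec (g (prod_encode i)))"
    show False
    proof (rule not_computable_from_closed[where T = "\<lambda>f. gdelta_point (\<zeta> (X f))" and e = e
          and H = "S2_functional k" and v = "\<lambda>j i. j" and P = ?P and R = ?R])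
      fix F :: tp2 and A Y assume F: "rfun_arg [O2 F] (spikes A Y)"
      let ?z = "\<zeta> (X (spikes A Y))"
      have "\<exists>c. ?dec c = ?z (m, n) \<and>
        kleene e (O2 (S2_functional k) # replicate r (O2 F) @ [O0 m, O0 n, O0 0]) c" for m n
        using e[OF arg'[OF F, of m n]] by (auto simp: rat_pair_name_def)
      then obtain c where c: "\<And>m n. ?dec (c m n) = ?z (m, n)"
        "\<And>m n. kleene e (O2 (S2_functional k) # replicate r (O2 F) @ [O0 m, O0 n, O0 0]) (c m n)"
        by metis
      have "(\<lambda>i. ?dec (case prod_decode (prod_encode i) of (m, n) \<Rightarrow> c m n)) = ?z"
        using c(1) by (auto simp: fun_eq_iff)
      then show "\<exists>c. (\<forall>n. kleene e (map (interp (\<lambda>j i. j) (S2_functional k) F) (?P n)) (c n)) \<and>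
          ?R c = gdelta_point ?z"
        by (intro exI[of _ "\<lambda>i. case prod_decode i of (m, n) \<Rightarrow> c m n"])
          (simp add: c(2) split: prod.split)
    qed (use T in auto)
  qed
  let ?Q = "\<lambda>G FA FY n c. \<exists>m. rat_of_code (fst (prod_decode (query G FA FY r [m, n, 0]))) < rat_of_code (lo c) \<and>
    rat_of_code (hi c) < rat_of_code (snd (prod_decode (query G FA FY r [m, n, 0])))"
  show "computes_cantor_realiser ?arg rat_pair_name (case_prod \<zeta>)"
  proof (rule computes_cantor_realiser_if_ecomp[where T = "\<lambda>f. gdelta_point (\<zeta> (X f))"
        and val = "\<lambda>G FA FY n. lo (nest (?Q G FA FY) n)", OF T])
    let ?L = "push (push (push (push oracles)))" and ?\<pi> = "\<lambda>u. fst (fst (fst (fst u)))"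
    let ?q = "\<lambda>u. query (fst (?\<pi> u)) (fst (snd (?\<pi> u))) (snd (snd (?\<pi> u))) r [snd u, snd (fst (fst u)), 0]"
    have "ecomp ?L (\<lambda>u. query (fst (?\<pi> u)) (fst (snd (?\<pi> u))) (snd (snd (?\<pi> u))) r
        (map (\<lambda>c. c u) [\<lambda>u. snd u, \<lambda>u. snd (fst (fst u)), \<lambda>u. 0]))"
      by (rule ecomp_query_oracles[where \<pi> = ?\<pi>])
        ((simp add: push_def oracles_def; fail)+, simp add: ecomp_vars ecomp_const)
    then have "ecomp ?L ?q" by (simp only: list.map)
    then have "edec ?L (\<lambda>u. rat_of_code (fst (prod_decode (?q u))) < rat_of_code (lo (snd (fst u))) \<and>
        rat_of_code (hi (snd (fst u))) < rat_of_code (snd (prod_decode (?q u))))"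
      by (intro edec_conj edec_rat_less ecomp_fst_prod_decode ecomp_snd_prod_decode ecomp_lo ecomp_hi
          ecomp_vars)
    then have "edec (push (push (push oracles))) (\<lambda>w. ?Q (fst (fst (fst (fst w))))
        (fst (snd (fst (fst (fst w))))) (snd (snd (fst (fst (fst w))))) (snd (fst w)) (snd w))"
      by (rule edec_ex)
    then show "ecomp (push oracles) (\<lambda>w. lo (nest (?Q (fst (fst w)) (fst (snd (fst w))) (snd (snd (fst w)))) (snd w)))"
      by (intro ecomp_lo ecomp_nest ecomp_vars)
    fix G FA FY A Y
    assume G: "presents ?arg rat_pair_name G (case_prod \<zeta>)" and F: "rfun_arg [O2 (spikes_rep FA FY)] (spikes A Y)"
    let ?z = "\<zeta> (X (spikes A Y))"
    have "?dec (query G FA FY r [m, n, 0]) = ?z (m, n)" for m n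
      using query_presents[OF G arg'[OF F, of m n], of "\<lambda>j. [m, n, j]"] by (simp add: rat_pair_name_def)
    then have "fst (?z (m, n)) = rat_of_code (fst (prod_decode (query G FA FY r [m, n, 0])))"
      "snd (?z (m, n)) = rat_of_code (snd (prod_decode (query G FA FY r [m, n, 0])))" for m n
      by (metis fst_map_prod, metis snd_map_prod)
    then show "real_name (\<lambda>n. lo (nest (?Q G FA FY) n)) (gdelta_point ?z)"
      unfolding gdelta_point_def by (simp only: real_name_nest_point)
  qed
qed

end

theorem theorem6:
  fixes k :: nat
  shows
    "(\<forall>\<Phi> :: (real \<Rightarrow> real) \<Rightarrow> real.
        (\<forall>f. usco01 f \<longrightarrow> \<Phi> f \<in> cont_points f) \<longrightarrow>
        \<not> computable_in_S2 k rfun_arg real_name \<Phi> \<and>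
        computes_cantor_realiser rfun_arg real_name \<Phi>)
   \<and> (\<forall>\<Psi> :: (real \<Rightarrow> real) \<Rightarrow> real \<times> real \<Rightarrow> real.
        (\<forall>f. usco01 f \<longrightarrow>
          (\<forall>p\<in>{0..1}. \<forall>q\<in>{0..1}. p \<le> q \<longrightarrow> \<Psi> f (p, q) = (SUP x\<in>{p..q}. f x))) \<longrightarrow>
        \<not> computable_in_S2 k (rfun_arg \<otimes>\<^sub>a real_arg \<otimes>\<^sub>a real_arg) real_name (case_prod \<Psi>) \<and>
        computes_cantor_realiser (rfun_arg \<otimes>\<^sub>a real_arg \<otimes>\<^sub>a real_arg) real_name (case_prod \<Psi>))
   \<and> (\<forall>\<zeta> :: (real \<Rightarrow> real) \<Rightarrow> nat \<times> nat \<Rightarrow> rat \<times> rat.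
        (\<forall>f. usco01 f \<longrightarrow>
          cont_points f =
            (\<Inter>n. \<Union>m. {real_of_rat (fst (\<zeta> f (m, n))) <..< real_of_rat (snd (\<zeta> f (m, n)))})) \<longrightarrow>
        \<not> computable_in_S2 k (rfun_arg \<otimes>\<^sub>a nat_arg \<otimes>\<^sub>a nat_arg) rat_pair_name (case_prod \<zeta>) \<and>
        computes_cantor_realiser (rfun_arg \<otimes>\<^sub>a nat_arg \<otimes>\<^sub>a nat_arg) rat_pair_name (case_prod \<zeta>))
   \<and> (\<forall>\<Phi> :: (real \<Rightarrow> real) \<times> (real \<Rightarrow> real) \<Rightarrow> real.
        (\<forall>f w. usco01 f \<longrightarrow> is_osc01 w f \<longrightarrow> \<Phi> (f, w) \<in> cont_points f) \<longrightarrow>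
        \<not> computable_in_S2 k (rfun_arg \<otimes>\<^sub>a rfun_arg) real_name \<Phi> \<and>
        computes_cantor_realiser (rfun_arg \<otimes>\<^sub>a rfun_arg) real_name \<Phi>)
   \<and> (\<forall>\<Psi> :: (real \<Rightarrow> real) \<times> (real \<Rightarrow> real) \<Rightarrow> real \<times> real \<Rightarrow> real.
        (\<forall>f w. usco01 f \<longrightarrow> is_osc01 w f \<longrightarrow>
          (\<forall>p\<in>{0..1}. \<forall>q\<in>{0..1}. p \<le> q \<longrightarrow> \<Psi> (f, w) (p, q) = (SUP x\<in>{p..q}. f x))) \<longrightarrow>
        \<not> computable_in_S2 k ((rfun_arg \<otimes>\<^sub>a rfun_arg) \<otimes>\<^sub>a real_arg \<otimes>\<^sub>a real_arg) real_name (case_prod \<Psi>) \<and>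
        computes_cantor_realiser ((rfun_arg \<otimes>\<^sub>a rfun_arg) \<otimes>\<^sub>a real_arg \<otimes>\<^sub>a real_arg) real_name (case_prod \<Psi>))
   \<and> (\<forall>\<zeta> :: (real \<Rightarrow> real) \<times> (real \<Rightarrow> real) \<Rightarrow> nat \<times> nat \<Rightarrow> rat \<times> rat.
        (\<forall>f w. usco01 f \<longrightarrow> is_osc01 w f \<longrightarrow>
          cont_points f =
            (\<Inter>n. \<Union>m. {real_of_rat (fst (\<zeta> (f, w) (m, n))) <..< real_of_rat (snd (\<zeta> (f, w) (m, n)))})) \<longrightarrow>
        \<not> computable_in_S2 k ((rfun_arg \<otimes>\<^sub>a rfun_arg) \<otimes>\<^sub>a nat_arg \<otimes>\<^sub>a nat_arg) rat_pair_name (case_prod \<zeta>) \<and>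
        computes_cantor_realiser ((rfun_arg \<otimes>\<^sub>a rfun_arg) \<otimes>\<^sub>a nat_arg \<otimes>\<^sub>a nat_arg) rat_pair_name (case_prod \<zeta>))"
proof -
  have arg1: "rfun_arg (replicate 1 (O2 F)) f" if "rfun_arg [O2 F] f" for F f
    using that by simp
  have arg2: "(rfun_arg \<otimes>\<^sub>a rfun_arg) (replicate 2 (O2 F)) (f, f)" if "rfun_arg [O2 F] f" for F f
    using that unfolding pair_arg_def by (intro exI[of _ "[O2 F]"]) (simp add: numeral_2_eq_2)
  note spikes = usco01_spikes is_osc01_spikes
  note f = continuity_point_functional[where arg = rfun_arg and X = "\<lambda>f. f" and r = 1]
    supremum_functional[where arg = rfun_arg and X = "\<lambda>f. f" and r = 1]
    gdelta_functional[where arg = rfun_arg and X = "\<lambda>f. f" and r = 1]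
  \<comment> \<open>The second component \<open>f\<close> acts as the oscillation function, which
    \<open>is_osc01_spikes\<close> justifies for spike functions.\<close>
  note ff = continuity_point_functional[where arg = "rfun_arg \<otimes>\<^sub>a rfun_arg" and X = "\<lambda>f. (f, f)" and r = 2]
    supremum_functional[where arg = "rfun_arg \<otimes>\<^sub>a rfun_arg" and X = "\<lambda>f. (f, f)" and r = 2]
    gdelta_functional[where arg = "rfun_arg \<otimes>\<^sub>a rfun_arg" and X = "\<lambda>f. (f, f)" and r = 2]
  show ?thesis
    apply (intro conjI allI impI)
    subgoal by (rule f(1), erule arg1) (blast intro: spikes)
    subgoal by (rule f(2), erule arg1) (blast intro: spikes)
    subgoal by (rule f(3), erule arg1) (blast intro: spikes)
    subgoal by (rule f(4), erule arg1) (blast intro: spikes)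
    subgoal by (rule f(5), erule arg1) (blast intro: spikes)
    subgoal by (rule f(6), erule arg1) (blast intro: spikes)
    subgoal by (rule ff(1), erule arg2) (blast intro: spikes)
    subgoal by (rule ff(2), erule arg2) (blast intro: spikes)
    subgoal by (rule ff(3), erule arg2) (blast intro: spikes)
    subgoal by (rule ff(4), erule arg2) (blast intro: spikes)
    subgoal by (rule ff(5), erule arg2) (blast intro: spikes)
    subgoal by (rule ff(6), erule arg2) (blast intro: spikes)
    done
qed

end
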